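(* Let $1<p<\infty$ and let $\Omega\subset M$ be an open set. Let $\lambda_1(\Omega)$ be the principal frequency of $\mathcal{L}_p$ in $\Omega$, and assume that there is a corresponding positive eigenfunction, i.e. a positive function $u_1\in \mathring{S}^{1,p}(\Omega)$ such that $$\int_{\Omega} |\nabla_X u_1|^{p-2}\langle \nabla_X u_1,\nabla_X\phi\rangle\, dx=\lambda_1(\Omega)\int_\Omega |u_1|^{p-2}u_1\phi\, dx\quad\text{for every }\phi\in \mathring{S}^{1,p}(\Omega).$$ If there exist $\lambda\in\mathbb{R}$ and a strictly positive $v\in\mathring{S}^{1,p}(\Omega)$ such that $$\int_{\Omega} |\nabla_X v|^{p-2}\langle \nabla_X v,\nabla_X\phi\rangle\, dx=\lambda\int_\Omega |v|^{p-2}v\phi\, dx$$ for every nonnegative function $\phi\in \mathring{S}^{1,p}(\Omega)$, then $\lambda_1(\Omega)=\lambda$.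
   Context: $M$ is a smooth manifold of dimension $n$ with a volume form $dx$, and $\{X_k\}_{k=1}^N$, $N\le n$, is a family of vector fields on $M$, $X_k=\sum_{j=1}^n a_{kj}(x)\frac{\partial}{\partial x_j}$, with formal adjoints $X_k^*$. Write $\nabla_X=(X_1,\dots,X_N)$, $\nabla_X^*=(X_1^*,\dots,X_N^* )$, let $\langle\cdot,\cdot\rangle$ be the Euclidean inner product on $\mathbb{R}^N$, and $|\nabla_X u|=\left(\sum_{k=1}^N (X_ku)^2\right)^{1/2}$. The $p$-sub-Laplacian is $\mathcal{L}_p f=\nabla_X^*\cdot(|\nabla_X f|^{p-2}\nabla_X f)$. For an open set $\Omega\subset M$, $\mathring{S}^{1,p}(\Omega)$ is the completion of $C_0^1(\Omega)$ in the norm generated by $J_p(u)=\left(\int_\Omega|\nabla_X u|^p dx\right)^{1/p}$; functions are real-valued. The principal Dirichlet frequency (first eigenvalue) of $\mathcal{L}_p$ in $\Omega$ is $$\lambda_1(\Omega):=\min_{u\in\mathring{S}^{1,p}(\Omega)}\left\{\int_\Omega|\nabla_X u|^p dx:\ \int_\Omega|u|^p dx=1\right\}.$$ *)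

theory Defs
  imports "HOL-Analysis.Analysis"
begin

section \<open>Smooth manifolds, volume forms and vector fields\<close>

text \<open>
  The manifold \<open>M\<close> is the whole type \<open>'m\<close>; the sort
  \<open>{t2_space, second_countable_topology}\<close> in the definition of \<open>smooth_atlas\<close>
  supplies the usual topological requirements. Its dimension is \<open>n = CARD('n)\<close>.
  A chart is a pair of an open set and a coordinate map.
\<close>

type_synonym ('m, 'n) chart = "'m set \<times> ('m \<Rightarrow> real ^ 'n)"

fun Ck_on :: "nat \<Rightarrow> 'a::real_normed_vector set \<Rightarrow> ('a \<Rightarrow> 'b::real_normed_vector) \<Rightarrow> bool" where
  "Ck_on 0 S f \<longleftrightarrow> continuous_on S f"
| "Ck_on (Suc k) S f \<longleftrightarrow>
     (\<forall>x\<in>S. f differentiable (at x)) \<and>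
     (\<forall>v. Ck_on k S (\<lambda>x. frechet_derivative f (at x) v))"

definition smooth_on :: "'a::real_normed_vector set \<Rightarrow> ('a \<Rightarrow> 'b::real_normed_vector) \<Rightarrow> bool" where
  "smooth_on S f \<longleftrightarrow> (\<forall>k. Ck_on k S f)"

definition chart_inv :: "('m, 'n) chart \<Rightarrow> real ^ 'n \<Rightarrow> 'm" where
  "chart_inv c = inv_into (fst c) (snd c)"

definition is_chart :: "('m::topological_space, 'n::finite) chart \<Rightarrow> bool" where
  "is_chart c \<longleftrightarrow> open (fst c) \<and> open (snd c ` fst c) \<and>
     homeomorphism (fst c) (snd c ` fst c) (snd c) (chart_inv c)"

definition overlap :: "('m, 'n) chart \<Rightarrow> ('m, 'n) chart \<Rightarrow> (real ^ 'n) set" where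
  "overlap c d = snd c ` (fst c \<inter> fst d)"

definition transition :: "('m, 'n) chart \<Rightarrow> ('m, 'n) chart \<Rightarrow> real ^ 'n \<Rightarrow> real ^ 'n" where
  "transition c d = snd d \<circ> chart_inv c"

definition smooth_atlas ::
  "('m::{t2_space, second_countable_topology}, 'n::finite) chart set \<Rightarrow> bool" where
  "smooth_atlas A \<longleftrightarrow> (\<forall>c\<in>A. is_chart c) \<and> (\<Union>c\<in>A. fst c) = UNIV \<and>
     (\<forall>c\<in>A. \<forall>d\<in>A. smooth_on (overlap c d) (transition c d))"

text \<open>
  A volume form is given by its coordinate representations
  \<open>w c dx\<^sub>1 \<and> \<dots> \<and> dx\<^sub>n\<close> in the charts \<open>c\<close>, with the transformation law of a
  differential form of top degree.
\<close>

definition volume_form ::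
  "('m, 'n::finite) chart set \<Rightarrow> (('m, 'n) chart \<Rightarrow> real ^ 'n \<Rightarrow> real) \<Rightarrow> bool" where
  "volume_form A w \<longleftrightarrow>
     (\<forall>c\<in>A. smooth_on (snd c ` fst c) (w c) \<and> (\<forall>x\<in>snd c ` fst c. w c x \<noteq> 0)) \<and>
     (\<forall>c\<in>A. \<forall>d\<in>A. \<forall>x\<in>overlap c d.
        w c x = w d (transition c d x) *
                det (matrix (frechet_derivative (transition c d) (at x))))"

text \<open>
  The measure \<open>dx\<close> induced by a volume form. As \<open>M\<close> is second countable, there is
  exactly one such Borel measure.
\<close>

definition volume_measure ::
  "('m::topological_space, 'n::finite) chart set \<Rightarrow> (('m, 'n) chart \<Rightarrow> real ^ 'n \<Rightarrow> real) \<Rightarrow>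
   'm measure \<Rightarrow> bool" where
  "volume_measure A w \<mu> \<longleftrightarrow> sets \<mu> = sets borel \<and>
     (\<forall>c\<in>A. \<forall>B\<in>sets borel. B \<subseteq> fst c \<longrightarrow>
        emeasure \<mu> B = (\<integral>\<^sup>+y\<in>snd c ` B. ennreal \<bar>w c y\<bar> \<partial>lborel))"

text \<open>
  A family of vector fields, with \<open>a c k x $ j\<close> the coefficient of
  \<open>\<partial>/\<partial>x\<^sub>j\<close> of \<open>X\<^sub>k\<close> in the chart \<open>c\<close>. The coefficients are only required to be
  continuously differentiable, which is what makes the formal adjoints
  \<open>X\<^sub>k\<^sup>* u = - (1/w) \<Sum>\<^sub>j \<partial>(w a\<^sub>k\<^sub>j u)/\<partial>x\<^sub>j\<close> classical first-order operators;
  smooth vector fields are covered.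
\<close>

definition vector_fields ::
  "('m, 'n::finite) chart set \<Rightarrow> (('m, 'n) chart \<Rightarrow> 'k \<Rightarrow> real ^ 'n \<Rightarrow> real ^ 'n) \<Rightarrow> bool" where
  "vector_fields A a \<longleftrightarrow>
     (\<forall>c\<in>A. \<forall>k. Ck_on 1 (snd c ` fst c) (a c k)) \<and>
     (\<forall>c\<in>A. \<forall>d\<in>A. \<forall>k. \<forall>x\<in>overlap c d.
        a d k (transition c d x) = frechet_derivative (transition c d) (at x) (a c k x))"

text \<open>
  \<open>nabla_X A a u m = (X\<^sub>1 u, \<dots>, X\<^sub>N u)(m)\<close> for a \<open>C\<^sup>1\<close> function \<open>u\<close>, where
  \<open>N = CARD('k)\<close>; by the transformation law of the coefficients it does not depend
  on the chart chosen around \<open>m\<close>.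
\<close>

definition nabla_X ::
  "('m, 'n::finite) chart set \<Rightarrow> (('m, 'n) chart \<Rightarrow> 'k \<Rightarrow> real ^ 'n \<Rightarrow> real ^ 'n) \<Rightarrow>
   ('m \<Rightarrow> real) \<Rightarrow> 'm \<Rightarrow> real ^ 'k::finite" where
  "nabla_X A a u m =
     (let c = (SOME c. c \<in> A \<and> m \<in> fst c) in
      \<chi> k. \<Sum>j\<in>UNIV. a c k (snd c m) $ j *
             frechet_derivative (u \<circ> chart_inv c) (at (snd c m)) (axis j 1))"


section \<open>The function space and the principal frequency\<close>

definition C01 ::
  "('m::topological_space, 'n::finite) chart set \<Rightarrow> 'm set \<Rightarrow> ('m \<Rightarrow> real) set" where
  "C01 A \<Omega> = {u. (\<forall>c\<in>A. Ck_on 1 (snd c ` fst c) (u \<circ> chart_inv c)) \<and>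
                compact (closure {m. u m \<noteq> 0}) \<and> closure {m. u m \<noteq> 0} \<subseteq> \<Omega>}"

text \<open>
  The completion of \<open>C01 A \<Omega>\<close> with respect to \<open>J\<^sub>p\<close>, realised by functions:
  \<open>S0_grad A a \<mu> p \<Omega> u G\<close> says that the function \<open>u\<close> on \<open>\<Omega>\<close> is an element of the
  completion and that \<open>\<nabla>\<^sub>X u = G\<close>. A \<open>J\<^sub>p\<close>-Cauchy sequence \<open>f\<close> is one whose gradients
  converge in \<open>L\<^sup>p(\<Omega>)\<close>, to \<open>G\<close> say; the function \<open>u\<close> that it determines is its limit
  in \<open>L\<^sup>1\<^sub>l\<^sub>o\<^sub>c(\<Omega>)\<close>. No convergence of \<open>f\<close> in \<open>L\<^sup>p(\<Omega>)\<close> is asked for. The gradient \<open>G\<close>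
  is determined by \<open>u\<close> up to null sets: integrating \<open>X\<^sub>k f\<^sub>i\<close> against a test function
  \<open>\<psi>\<close> and using \<open>X\<^sub>k\<^sup>*\<close> shows that the integral of \<open>G\<^sub>k \<psi>\<close> is that of \<open>u X\<^sub>k\<^sup>* \<psi>\<close>.
\<close>

definition S0_grad ::
  "('m::topological_space, 'n::finite) chart set \<Rightarrow>
   (('m, 'n) chart \<Rightarrow> 'k \<Rightarrow> real ^ 'n \<Rightarrow> real ^ 'n) \<Rightarrow> 'm measure \<Rightarrow> real \<Rightarrow> 'm set \<Rightarrow>
   ('m \<Rightarrow> real) \<Rightarrow> ('m \<Rightarrow> real ^ 'k::finite) \<Rightarrow> bool" where
  "S0_grad A a \<mu> p \<Omega> u G \<longleftrightarrow>
     set_borel_measurable \<mu> \<Omega> u \<and> set_borel_measurable \<mu> \<Omega> G \<and>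
     (\<exists>f. (\<forall>i::nat. f i \<in> C01 A \<Omega>) \<and>
        (\<forall>K. compact K \<longrightarrow> K \<subseteq> \<Omega> \<longrightarrow>
           (\<lambda>i. \<integral>\<^sup>+m\<in>K. ennreal \<bar>f i m - u m\<bar> \<partial>\<mu>) \<longlonglongrightarrow> 0) \<and>
        (\<lambda>i. \<integral>\<^sup>+m\<in>\<Omega>. ennreal (norm (nabla_X A a (f i) m - G m) powr p) \<partial>\<mu>) \<longlonglongrightarrow> 0)"

definition principal_frequency ::
  "('m::topological_space, 'n::finite) chart set \<Rightarrow>
   (('m, 'n) chart \<Rightarrow> 'k::finite \<Rightarrow> real ^ 'n \<Rightarrow> real ^ 'n) \<Rightarrow> 'm measure \<Rightarrow> real \<Rightarrow> 'm set \<Rightarrow>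
   real \<Rightarrow> bool" where
  "principal_frequency A a \<mu> p \<Omega> l \<longleftrightarrow>
     (let E = {LINT m:\<Omega>|\<mu>. norm (G m) powr p | u G.
                 S0_grad A a \<mu> p \<Omega> u G \<and> (LINT m:\<Omega>|\<mu>. \<bar>u m\<bar> powr p) = 1}
      in l \<in> E \<and> (\<forall>e\<in>E. l \<le> e))"

text \<open>
  The weak eigenvalue equation for \<open>u\<close> with \<open>\<nabla>\<^sub>X u = G\<close>, tested against \<open>\<phi>\<close> with
  \<open>\<nabla>\<^sub>X \<phi> = \<Phi>\<close>. Since the Bochner integral of a non-integrable function is \<open>0\<close>,
  the existence of the right-hand integral has to be said; the left-hand integrand
  is integrable because \<open>G\<close> and \<open>\<Phi>\<close> are in \<open>L\<^sup>p(\<Omega>)\<close>. The convention \<open>0 powr b = 0\<close> makes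
  both integrands vanish where \<open>G\<close>, respectively \<open>u\<close>, vanishes, also for \<open>p < 2\<close>.
\<close>

definition weak_eigen_eq ::
  "'m measure \<Rightarrow> real \<Rightarrow> 'm set \<Rightarrow> real \<Rightarrow> ('m \<Rightarrow> real) \<Rightarrow> ('m \<Rightarrow> real ^ 'k::finite) \<Rightarrow>
   ('m \<Rightarrow> real) \<Rightarrow> ('m \<Rightarrow> real ^ 'k) \<Rightarrow> bool" where
  "weak_eigen_eq \<mu> p \<Omega> l u G \<phi> \<Phi> \<longleftrightarrow>
     set_integrable \<mu> \<Omega> (\<lambda>m. \<bar>u m\<bar> powr (p - 2) * u m * \<phi> m) \<and>
     (LINT m:\<Omega>|\<mu>. norm (G m) powr (p - 2) * inner (G m) (\<Phi> m)) =
       l * (LINT m:\<Omega>|\<mu>. \<bar>u m\<bar> powr (p - 2) * u m * \<phi> m)"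

end

theory Submission
  imports Defs
begin

text \<open>
  Testing its own equation with \<open>v\<close> shows that the normalised \<open>v\<close> has energy \<open>lam\<close>, so
  \<open>lam1 \<le> lam\<close>. For the converse, test the equation of \<open>v\<close> with
  \<open>\<bar>\<phi>\<bar>\<^sup>p (v + e)\<^sup>1\<^sup>-\<^sup>p\<close> for \<open>\<phi>\<close> in \<open>C01\<close>. Picone's inequality, which is Young's inequality
  applied pointwise, bounds the left-hand side by the integral of \<open>\<bar>\<nabla>\<phi>\<bar>\<^sup>p\<close>, and letting
  \<open>e \<rightarrow> 0\<close> gives \<open>lam \<integral>\<bar>\<phi>\<bar>\<^sup>p \<le> \<integral>\<bar>\<nabla>\<phi>\<bar>\<^sup>p\<close>. Convergence in the completion is only
  \<open>L\<^sup>1\<close> on compact sets for the functions themselves, so this inequality is passed to the limit by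
  Fatou's lemma on an exhaustion by compact sets. Applied to a minimiser it yields \<open>lam \<le> lam1\<close>.
\<close>

section \<open>Horizontal gradients of continuously differentiable functions\<close>

text \<open>The obstacle is that \<open>v\<close> has no positive lower bound on the support of
  \<phi>, so a negative power of \<open>v\<close> need not give an admissible test function. The
  shift \<open>e\<close> makes the power bounded with a bounded derivative, and this is what
  \<open>S0_grad_mult_compose\<close> needs in order to exhibit approximants in \<open>C01\<close>.
  The shift costs nothing on the gradient side: \<open>v + e\<close> has the gradient of
  \<open>v\<close>, so Picone's inequality applies to it directly. It shows only in the eigenvalue
  term, as the factor \<open>v powr (p - 1) * (v + e) powr (1 - p)\<close>, which lies below 1 and
  tends to 1. The limit in the completion must not lose a constant in front of the energy. Therefore
  the triangle inequality for \<open>p\<close>-th powers carries a weight \<open>t\<close>, whose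
  main coefficient \<open>(1 - t) powr (1 - p)\<close> tends to 1 as \<open>t\<close> tends to 0.
  The inequality \<open>lam1 \<le> lam\<close> comes first because it also yields
  \<open>0 \<le> lam\<close>: only for a nonnegative factor is the bound on \<open>C01\<close> an
  inequality of extended nonnegative integrals, to which Fatou's lemma applies in the right
  direction.\<close>

lemma Ck_on_1:
  "Ck_on 1 S f \<longleftrightarrow> (\<forall>x\<in>S. f differentiable (at x)) \<and>
     (\<forall>v. continuous_on S (\<lambda>x. frechet_derivative f (at x) v))"
  by simp

lemma Ck_on_1I:
  assumes "\<And>x. x \<in> S \<Longrightarrow> (f has_derivative f' x) (at x)"
    and "\<And>v. continuous_on S (\<lambda>x. f' x v)"
  shows "Ck_on 1 S f"
proof -
  have "frechet_derivative f (at x) = f' x" if "x \<in> S" for x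
    using frechet_derivative_at[OF assms(1)[OF that]] by simp
  then have "continuous_on S (\<lambda>x. frechet_derivative f (at x) v)" for v
    using continuous_on_cong[of S S "\<lambda>x. frechet_derivative f (at x) v" "\<lambda>x. f' x v"]
      assms(2)[of v] by simp
  then show ?thesis
    unfolding Ck_on_1 using assms(1) by (auto simp: differentiable_def)
qed

lemma Ck_on_1_has_derivative:
  "Ck_on 1 S f \<Longrightarrow> x \<in> S \<Longrightarrow> (f has_derivative frechet_derivative f (at x)) (at x)"
  unfolding Ck_on_1 using frechet_derivative_works by blast

lemma Ck_on_1_continuous_derivative:
  "Ck_on 1 S f \<Longrightarrow> continuous_on S (\<lambda>x. frechet_derivative f (at x) v)"
  unfolding Ck_on_1 by blast

lemma Ck_on_1_continuous: "Ck_on 1 S f \<Longrightarrow> continuous_on S f"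
  unfolding Ck_on_1
  by (meson continuous_at_imp_continuous_on differentiable_imp_continuous_within)

lemma has_derivative_compose_real:
  fixes f :: "'a::real_normed_vector \<Rightarrow> real"
  assumes "(f has_derivative f') (at x)" "(g has_real_derivative d) (at (f x))"
  shows "((\<lambda>y. g (f y)) has_derivative (\<lambda>v. d * f' v)) (at x)"
  using has_derivative_compose[OF assms(1) assms(2)[unfolded has_field_derivative_def]] .

lemma Ck_on_1_compose_real:
  fixes f :: "'a::real_normed_vector \<Rightarrow> real"
  assumes "Ck_on 1 S f" "\<And>t. (g has_real_derivative g' t) (at t)" "continuous_on UNIV g'"
  shows "Ck_on 1 S (\<lambda>x. g (f x))"
proof (rule Ck_on_1I)
  show "((\<lambda>y. g (f y)) has_derivative (\<lambda>v. g' (f x) * frechet_derivative f (at x) v)) (at x)"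
    if "x \<in> S" for x
    using Ck_on_1_has_derivative[OF assms(1) that] assms(2) by (rule has_derivative_compose_real)
  have "continuous_on S (\<lambda>x. g' (f x))"
    using continuous_on_compose2[OF assms(3) Ck_on_1_continuous[OF assms(1)]] by simp
  then show "continuous_on S (\<lambda>x. g' (f x) * frechet_derivative f (at x) v)" for v
    by (intro continuous_intros Ck_on_1_continuous_derivative[OF assms(1)])
qed

lemma Ck_on_1_mult:
  fixes f g :: "'a::real_normed_vector \<Rightarrow> real"
  assumes "Ck_on 1 S f" "Ck_on 1 S g"
  shows "Ck_on 1 S (\<lambda>x. f x * g x)"
proof (rule Ck_on_1I)
  show "((\<lambda>x. f x * g x) has_derivative
      (\<lambda>v. f x * frechet_derivative g (at x) v + frechet_derivative f (at x) v * g x)) (at x)"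
    if "x \<in> S" for x
    using Ck_on_1_has_derivative[OF assms(1) that] Ck_on_1_has_derivative[OF assms(2) that]
    by (rule has_derivative_mult)
  show "continuous_on S
      (\<lambda>x. f x * frechet_derivative g (at x) v + frechet_derivative f (at x) v * g x)" for v
    by (intro continuous_intros Ck_on_1_continuous_derivative Ck_on_1_continuous assms)
qed

text \<open>Converts between the coordinate sum in \<open>nabla_X\<close> and a single derivative in
  the direction of the vector field.\<close>

lemma linear_axis_expansion:
  fixes f :: "real ^ 'n::finite \<Rightarrow> real"
  assumes "linear f"
  shows "(\<Sum>j\<in>UNIV. y $ j * f (axis j 1)) = f y"
proof -
  have "f y = f (\<Sum>j\<in>UNIV. y $ j *\<^sub>R axis j 1)"
    using basis_expansion[of y] by (simp add: scalar_mult_eq_scaleR)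
  also have "\<dots> = (\<Sum>j\<in>UNIV. y $ j * f (axis j 1))"
    by (simp add: linear_sum[OF assms] linear_scale[OF assms])
  finally show ?thesis ..
qed

text \<open>This is \<open>C01\<close> without the condition on the support. A composition
  \<open>g (u m)\<close> with \<open>g 0 \<noteq> 0\<close> generally leaves \<open>C01\<close> but
  stays in this class, and a compactly supported factor brings it back.\<close>

definition C1_fun ::
  "('m::topological_space, 'n::finite) chart set \<Rightarrow> ('m \<Rightarrow> real) \<Rightarrow> bool" where
  "C1_fun A u \<longleftrightarrow> (\<forall>c\<in>A. Ck_on 1 (snd c ` fst c) (u \<circ> chart_inv c))"

lemma C01_C1_fun: "u \<in> C01 A \<Omega> \<Longrightarrow> C1_fun A u"
  by (simp add: C01_def C1_fun_def)

lemma C1_fun_mult: "C1_fun A u \<Longrightarrow> C1_fun A v \<Longrightarrow> C1_fun A (\<lambda>m. u m * v m)"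
  unfolding C1_fun_def o_def using Ck_on_1_mult by fast

lemma C1_fun_compose:
  "C1_fun A u \<Longrightarrow> (\<And>t. (g has_real_derivative g' t) (at t)) \<Longrightarrow> continuous_on UNIV g' \<Longrightarrow>
   C1_fun A (\<lambda>m. g (u m))"
  unfolding C1_fun_def o_def using Ck_on_1_compose_real[of _ _ g g'] by fast

section \<open>Horizontal gradient: independence of the chart, continuity and calculus rules\<close>

locale horizontal_frame =
  fixes A :: "('m::{t2_space, second_countable_topology}, 'n::finite) chart set"
    and w :: "('m, 'n) chart \<Rightarrow> real ^ 'n \<Rightarrow> real"
    and \<mu> :: "'m measure"
    and a :: "('m, 'n) chart \<Rightarrow> 'k::finite \<Rightarrow> real ^ 'n \<Rightarrow> real ^ 'n"
  assumes atlas: "smooth_atlas A" and vol: "volume_form A w" and meas: "volume_measure A w \<mu>"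
    and fields: "vector_fields A a"
begin

lemma chart: "c \<in> A \<Longrightarrow> is_chart c"
  using atlas by (simp add: smooth_atlas_def)

lemma chart_domain_open: "c \<in> A \<Longrightarrow> open (fst c)"
  and chart_image_open: "c \<in> A \<Longrightarrow> open (snd c ` fst c)"
  and chart_homeomorphism:
    "c \<in> A \<Longrightarrow> homeomorphism (fst c) (snd c ` fst c) (snd c) (chart_inv c)"
  using chart by (auto simp: is_chart_def)

lemma chart_inv_chart: "c \<in> A \<Longrightarrow> m \<in> fst c \<Longrightarrow> chart_inv c (snd c m) = m"
  using homeomorphism_apply1[OF chart_homeomorphism] .

lemma chart_continuous: "c \<in> A \<Longrightarrow> continuous_on (fst c) (snd c)"
  using homeomorphism_cont1[OF chart_homeomorphism] .

lemma chart_around: obtains c where "c \<in> A" "m \<in> fst c"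
  using atlas unfolding smooth_atlas_def by blast

lemma continuous_if_continuous_on_charts:
  assumes "\<And>c. c \<in> A \<Longrightarrow> continuous_on (fst c) f"
  shows "continuous_on UNIV f"
  by (metis UNIV_I assms chart_around chart_domain_open continuous_at_imp_continuous_on
      continuous_on_eq_continuous_at)

lemma chart_image_open_subset:
  assumes "c \<in> A" "open U" "U \<subseteq> fst c"
  shows "open (snd c ` U)"
proof -
  have "openin (top_of_set (fst c)) U"
    using assms chart_domain_open openin_open_eq by blast
  from homeomorphism_imp_open_map[OF chart_homeomorphism[OF assms(1)] this]
  show ?thesis using chart_image_open[OF assms(1)] openin_open_eq by blast
qed

lemma C1_fun_continuous:
  assumes "C1_fun A u"
  shows "continuous_on UNIV u"
proof (rule continuous_if_continuous_on_charts)
  fix c assume c: "c \<in> A"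
  have "continuous_on (snd c ` fst c) (u \<circ> chart_inv c)"
    using assms c Ck_on_1_continuous unfolding C1_fun_def by blast
  then have "continuous_on (fst c) ((u \<circ> chart_inv c) \<circ> snd c)"
    by (rule continuous_on_compose[OF chart_continuous[OF c]])
  then show "continuous_on (fst c) u"
    by (rule continuous_on_eq) (simp add: chart_inv_chart c)
qed

lemma C1_fun_derivative:
  assumes "C1_fun A u" "c \<in> A" "m \<in> fst c"
  shows "(u \<circ> chart_inv c has_derivative frechet_derivative (u \<circ> chart_inv c) (at (snd c m)))
    (at (snd c m))"
proof (rule Ck_on_1_has_derivative)
  show "Ck_on 1 (snd c ` fst c) (u \<circ> chart_inv c)" using assms unfolding C1_fun_def by simp
qed (use assms in blast)

text \<open>On the overlap, an open neighbourhood of the point, \<open>u \<circ> chart_inv c\<close>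
  is \<open>u \<circ> chart_inv d\<close> after the transition map. The chain rule then matches the
  transformation law of the coefficients. This makes the arbitrary choice of a chart in
  \<open>nabla_X\<close> harmless.\<close>

lemma frechet_derivative_chart_change:
  assumes u: "C1_fun A u" and c: "c \<in> A" "m \<in> fst c" and d: "d \<in> A" "m \<in> fst d"
  shows "frechet_derivative (u \<circ> chart_inv c) (at (snd c m)) (a c k (snd c m)) =
    frechet_derivative (u \<circ> chart_inv d) (at (snd d m)) (a d k (snd d m))"
proof -
  let ?x = "snd c m" and ?T = "transition c d"
  have x: "?x \<in> overlap c d" unfolding overlap_def using c d by blast
  have op: "open (overlap c d)" unfolding overlap_def
    using c(1) d(1) by (intro chart_image_open_subset open_Int chart_domain_open) auto
  have Tx: "?T ?x = snd d m" by (simp add: transition_def chart_inv_chart c)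
  have "Ck_on 1 (overlap c d) ?T"
    using atlas c(1) d(1) unfolding smooth_atlas_def smooth_on_def by blast
  from Ck_on_1_has_derivative[OF this x]
  have T: "(?T has_derivative frechet_derivative ?T (at ?x)) (at ?x)" .
  have "((\<lambda>y. (u \<circ> chart_inv d) (?T y)) has_derivative
     (\<lambda>v. frechet_derivative (u \<circ> chart_inv d) (at (snd d m)) (frechet_derivative ?T (at ?x) v)))
     (at ?x)"
    by (rule has_derivative_compose[OF T]) (use C1_fun_derivative[OF u d] in \<open>simp only: Tx\<close>)
  moreover have "(u \<circ> chart_inv d) (?T y) = (u \<circ> chart_inv c) y" if "y \<in> overlap c d" for y
    using that by (auto simp: overlap_def transition_def chart_inv_chart c d)
  ultimately have "(u \<circ> chart_inv c has_derivative
     (\<lambda>v. frechet_derivative (u \<circ> chart_inv d) (at (snd d m)) (frechet_derivative ?T (at ?x) v)))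
     (at ?x)"
    by (rule has_derivative_transform_within_open[OF _ op x])
  moreover have "a d k (?T ?x) = frechet_derivative ?T (at ?x) (a c k ?x)"
    using fields c(1) d(1) x unfolding vector_fields_def by simp
  ultimately show ?thesis
    by (simp add: frechet_derivative_at[symmetric] Tx)
qed

lemma nabla_X_chart:
  assumes u: "C1_fun A u" and c: "c \<in> A" "m \<in> fst c"
  shows "nabla_X A a u m =
    (\<chi> k. frechet_derivative (u \<circ> chart_inv c) (at (snd c m)) (a c k (snd c m)))"
proof -
  define d where "d = (SOME c. c \<in> A \<and> m \<in> fst c)"
  have d: "d \<in> A" "m \<in> fst d"
    using someI[of "\<lambda>c. c \<in> A \<and> m \<in> fst c" c] c unfolding d_def by blast+
  have "linear (frechet_derivative (u \<circ> chart_inv d) (at (snd d m)))"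
    using C1_fun_derivative[OF u d] has_derivative_linear by blast
  then have "nabla_X A a u m =
      (\<chi> k. frechet_derivative (u \<circ> chart_inv d) (at (snd d m)) (a d k (snd d m)))"
    unfolding nabla_X_def d_def[symmetric] Let_def by (simp add: linear_axis_expansion)
  then show ?thesis
    using frechet_derivative_chart_change[OF u c d] by simp
qed

text \<open>The chart chosen inside \<open>nabla_X\<close> may jump from point to point, so
  continuity is checked with one chart fixed on its whole domain.\<close>

lemma nabla_X_continuous:
  assumes u: "C1_fun A u"
  shows "continuous_on UNIV (nabla_X A a u)"
proof (rule continuous_if_continuous_on_charts)
  fix c assume c: "c \<in> A"
  let ?D = "\<lambda>x. frechet_derivative (u \<circ> chart_inv c) (at x)"
  have "continuous_on (snd c ` fst c) (\<lambda>x. ?D x v)" for v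
    using u c Ck_on_1_continuous_derivative unfolding C1_fun_def by blast
  moreover have "continuous_on (snd c ` fst c) (a c k)" for k
    using fields c Ck_on_1_continuous unfolding vector_fields_def by blast
  \<comment> \<open>The derivative is known to be continuous only in a fixed direction, while
    \<open>a c k x\<close> varies with \<open>x\<close>; expanding along the axes separates the two
    dependences.\<close>
  ultimately have "continuous_on (snd c ` fst c)
      (\<lambda>x. \<chi> k. \<Sum>j\<in>UNIV. a c k x $ j * ?D x (axis j 1))"
    by (intro continuous_intros continuous_on_vec_lambda)
  then have "continuous_on (fst c)
      (\<lambda>m. \<chi> k. \<Sum>j\<in>UNIV. a c k (snd c m) $ j * ?D (snd c m) (axis j 1))"
    using chart_continuous[OF c] by (rule continuous_on_compose2) auto
  moreover have "(\<chi> k. \<Sum>j\<in>UNIV. a c k (snd c m) $ j * ?D (snd c m) (axis j 1)) = nabla_X A a u m"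
    if m: "m \<in> fst c" for m
    using C1_fun_derivative[OF u c m] nabla_X_chart[OF u c m]
    by (simp add: linear_axis_expansion has_derivative_linear)
  ultimately show "continuous_on (fst c) (nabla_X A a u)"
    by (rule continuous_on_eq)
qed

lemma nabla_X_compose:
  assumes u: "C1_fun A u" and g: "\<And>t. (g has_real_derivative g' t) (at t)" "continuous_on UNIV g'"
  shows "nabla_X A a (\<lambda>m. g (u m)) m = g' (u m) *\<^sub>R nabla_X A a u m"
proof -
  obtain c where c: "c \<in> A" "m \<in> fst c" by (rule chart_around)
  have "((\<lambda>m. g (u m)) \<circ> chart_inv c has_derivative
      (\<lambda>v. g' (u m) * frechet_derivative (u \<circ> chart_inv c) (at (snd c m)) v)) (at (snd c m))"
    using has_derivative_compose_real[OF C1_fun_derivative[OF u c], of g "g' (u m)"] g(1)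
    by (simp add: o_def chart_inv_chart c)
  from frechet_derivative_at[OF this, symmetric] show ?thesis
    by (simp add: nabla_X_chart[OF u c] nabla_X_chart[OF C1_fun_compose[OF u g] c] vec_eq_iff)
qed

lemma nabla_X_mult:
  assumes u: "C1_fun A u" and v: "C1_fun A v"
  shows "nabla_X A a (\<lambda>m. u m * v m) m = u m *\<^sub>R nabla_X A a v m + v m *\<^sub>R nabla_X A a u m"
proof -
  obtain c where c: "c \<in> A" "m \<in> fst c" by (rule chart_around)
  have "((\<lambda>m. u m * v m) \<circ> chart_inv c has_derivative
      (\<lambda>x. u m * frechet_derivative (v \<circ> chart_inv c) (at (snd c m)) x +
           frechet_derivative (u \<circ> chart_inv c) (at (snd c m)) x * v m)) (at (snd c m))"
    using has_derivative_mult[OF C1_fun_derivative[OF u c] C1_fun_derivative[OF v c]]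
    by (simp add: o_def chart_inv_chart c)
  from frechet_derivative_at[OF this, symmetric] show ?thesis
    by (simp add: nabla_X_chart[OF u c] nabla_X_chart[OF v c] nabla_X_chart[OF C1_fun_mult[OF u v] c]
        vec_eq_iff)
qed

text \<open>Off the closure of the support, \<open>u\<close> vanishes on a whole neighbourhood,
  hence so does its derivative. At a mere zero of \<open>u\<close> this could fail.\<close>

lemma nabla_X_eq_0:
  assumes u: "C1_fun A u" and m: "m \<notin> closure {m. u m \<noteq> 0}"
  shows "nabla_X A a u m = 0"
proof -
  obtain c where c: "c \<in> A" "m \<in> fst c" by (rule chart_around)
  let ?U = "fst c - closure {m. u m \<noteq> 0}"
  have "open (snd c ` ?U)"
    using c by (intro chart_image_open_subset open_Diff chart_domain_open) auto
  moreover have "snd c m \<in> snd c ` ?U" using c m by blast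
  moreover have "(u \<circ> chart_inv c) y = 0" if "y \<in> snd c ` ?U" for y
    using that c closure_subset[of "{m. u m \<noteq> 0}"] by (auto simp: chart_inv_chart)
  ultimately have "(u \<circ> chart_inv c has_derivative (\<lambda>v. 0)) (at (snd c m))"
    using has_derivative_transform_within_open[OF has_derivative_const[of 0]] by metis
  from frechet_derivative_at[OF this, symmetric] show ?thesis
    by (simp add: nabla_X_chart[OF u c] vec_eq_iff)
qed

end

section \<open>Integration\<close>

text \<open>Convexity of the power at
  \<open>(1 - t) * (norm x / (1 - t)) + t * (norm y / t)\<close>. For small \<open>t\<close> the
  first coefficient is close to 1, which replaces Minkowski's inequality in limits of energies;
  \<open>t = 1/2\<close> serves where only finiteness or convergence to 0 matters.\<close>

lemma norm_add_powr_le: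
  fixes x y :: "'a::real_normed_vector"
  assumes p: "1 \<le> p" and t: "0 < t" "t < 1"
  shows "norm (x + y) powr p \<le> (1 - t) powr (1 - p) * norm x powr p + t powr (1 - p) * norm y powr p"
proof -
  have ge1: "1 \<le> s powr (1 - p)" if "0 < s" "s < 1" for s :: real
    using powr_mono'[of "1 - p" 0 s] that p by simp
  have scale: "s * (z / s) powr p = s powr (1 - p) * z powr p" if "0 < s" "0 \<le> z" for s z :: real
    using that by (simp add: powr_divide powr_diff)
  have "norm (x + y) powr p \<le> (norm x + norm y) powr p"
    using p by (intro powr_mono2 norm_triangle_ineq) auto
  also have "\<dots> \<le> (1 - t) powr (1 - p) * norm x powr p + t powr (1 - p) * norm y powr p"
  proof (cases "x = 0 \<or> y = 0")
    case True
    then show ?thesis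
      using mult_right_mono[OF ge1[of t], of "norm y powr p"]
        mult_right_mono[OF ge1[of "1 - t"], of "norm x powr p"] t by auto
  next
    case False
    have "((1 - t) *\<^sub>R (norm x / (1 - t)) + t *\<^sub>R (norm y / t)) powr p
        \<le> (1 - t) * (norm x / (1 - t)) powr p + t * (norm y / t) powr p"
      using False t by (intro convex_onD[OF powr_convex[OF p]]) auto
    then show ?thesis using t by (simp add: scale)
  qed
  finally show ?thesis .
qed

text \<open>Young's inequality for \<open>b\<close> and \<open>s powr (p - 1)\<close> with the
  conjugate exponents \<open>p\<close> and \<open>p / (p - 1)\<close>, multiplied by
  \<open>p\<close>. Picone's inequality uses it in this form.\<close>

lemma Young_powr:
  fixes s b p :: real
  assumes p: "1 < p" and "0 \<le> s" "0 \<le> b"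
  shows "p * s powr (p - 1) * b \<le> (p - 1) * s powr p + b powr p"
proof -
  have "b * s powr (p - 1) \<le> b powr p / p + (s powr (p - 1)) powr (p / (p - 1)) / (p / (p - 1))"
    using assms by (intro Youngs_inequality) (auto simp: field_simps)
  also have "(s powr (p - 1)) powr (p / (p - 1)) = s powr p"
    using p by (simp add: powr_powr)
  finally show ?thesis using p by (simp add: field_simps)
qed

lemma AE_subseq_of_nn_integral_tendsto_0:
  fixes f :: "nat \<Rightarrow> 'a \<Rightarrow> real"
  assumes [measurable]: "\<And>i. f i \<in> borel_measurable M" "u \<in> borel_measurable M" "K \<in> sets M"
    and lim: "(\<lambda>i. \<integral>\<^sup>+m\<in>K. ennreal \<bar>f i m - u m\<bar> \<partial>M) \<longlonglongrightarrow> 0"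
  obtains r :: "nat \<Rightarrow> nat" where "strict_mono r" "AE m in M. m \<in> K \<longrightarrow> (\<lambda>i. f (r i) m) \<longlonglongrightarrow> u m"
proof -
  let ?I = "\<lambda>i. \<integral>\<^sup>+m\<in>K. ennreal \<bar>f i m - u m\<bar> \<partial>M"
  have "\<forall>\<^sub>F i in sequentially. ?I i < \<infinity>"
    using order_tendstoD(2)[OF lim] by (simp add: top.not_eq_extremum)
  \<comment> \<open>Convergence to 0 of extended integrals allows finitely many infinite ones, so
    the sequence is shifted past them before the integrability of its members is claimed.\<close>
  then obtain N where N: "\<And>i. i \<ge> N \<Longrightarrow> ?I i < \<infinity>"
    unfolding eventually_sequentially by blast
  define h where "h i m = indicator K m * (f (i + N) m - u m)" for i m
  have h: "(\<integral>\<^sup>+m. ennreal (norm (h i m)) \<partial>M) = ?I (i + N)" for i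
    unfolding h_def by (intro nn_integral_cong) (auto simp: indicator_def abs_mult)
  have int: "integrable M (h i)" for i
  proof (rule integrableI_bounded)
    show "h i \<in> borel_measurable M" unfolding h_def by measurable
  qed (use h N in simp)
  have "(\<lambda>i. ennreal (\<integral>m. norm (h i m) \<partial>M)) \<longlonglongrightarrow> ennreal 0"
    using LIMSEQ_ignore_initial_segment[OF lim, of N]
    by (simp add: nn_integral_eq_integral[symmetric] int h[symmetric])
  then have "(\<lambda>i. \<integral>m. norm (h i m) \<partial>M) \<longlonglongrightarrow> 0"
    by (subst (asm) tendsto_ennreal_iff) auto
  from tendsto_L1_AE_subseq[OF int this] obtain r where
    r: "strict_mono r" "AE m in M. (\<lambda>i. h (r i) m) \<longlonglongrightarrow> 0" by blast
  show thesis
  proof (rule that[of "\<lambda>i. r i + N"])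
    show "strict_mono (\<lambda>i. r i + N)" using r(1) by (simp add: strict_mono_def)
    show "AE m in M. m \<in> K \<longrightarrow> (\<lambda>i. f (r i + N) m) \<longlonglongrightarrow> u m"
      using r(2) by eventually_elim (auto simp: h_def intro: LIM_zero_cancel)
  qed
qed

lemma nn_integral_powr_norm_add:
  fixes x y :: "'a \<Rightarrow> 'b::{real_normed_vector, second_countable_topology}"
  assumes [measurable]: "x \<in> borel_measurable M" "y \<in> borel_measurable M" "S \<in> sets M"
    and p: "1 \<le> p" and t: "0 < t" "t < 1"
  shows "(\<integral>\<^sup>+m\<in>S. ennreal (norm (x m + y m) powr p) \<partial>M) \<le>
    ennreal ((1 - t) powr (1 - p)) * (\<integral>\<^sup>+m\<in>S. ennreal (norm (x m) powr p) \<partial>M) +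
    ennreal (t powr (1 - p)) * (\<integral>\<^sup>+m\<in>S. ennreal (norm (y m) powr p) \<partial>M)"
proof -
  have "(\<integral>\<^sup>+m\<in>S. ennreal (norm (x m + y m) powr p) \<partial>M) \<le>
    (\<integral>\<^sup>+m. ennreal ((1 - t) powr (1 - p)) * (ennreal (norm (x m) powr p) * indicator S m) +
      ennreal (t powr (1 - p)) * (ennreal (norm (y m) powr p) * indicator S m) \<partial>M)"
    by (intro nn_integral_mono)
      (auto simp: indicator_def ennreal_mult[symmetric] ennreal_plus[symmetric] norm_add_powr_le p t
        simp del: ennreal_plus)
  also have "\<dots> = ennreal ((1 - t) powr (1 - p)) * (\<integral>\<^sup>+m\<in>S. ennreal (norm (x m) powr p) \<partial>M) +
    ennreal (t powr (1 - p)) * (\<integral>\<^sup>+m\<in>S. ennreal (norm (y m) powr p) \<partial>M)"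
    by (subst nn_integral_add; (subst nn_integral_cmult)?) (auto simp: nn_integral_cmult)
  finally show ?thesis .
qed

lemma integrable_compactly_supported:
  fixes f :: "'a::t2_space \<Rightarrow> 'b::{banach, second_countable_topology}"
  assumes "sets M = sets borel" "compact K" "emeasure M K < \<infinity>"
    and f: "continuous_on UNIV f" "\<And>x. x \<notin> K \<Longrightarrow> f x = 0"
  shows "integrable M f"
proof -
  have "bounded (f ` K)"
    using compact_continuous_image[OF continuous_on_subset[OF f(1)]] assms(2)
    by (blast intro: compact_imp_bounded)
  then obtain B where B: "\<And>x. x \<in> K \<Longrightarrow> norm (f x) \<le> B"
    unfolding bounded_iff by blast
  have "f \<in> borel_measurable M"
    using borel_measurable_continuous_onI[OF f(1)] assms(1) measurable_cong_sets by blast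
  moreover have "K \<in> sets M"
    using assms(1) compact_imp_closed[OF assms(2)] by auto
  ultimately show ?thesis
    using assms(3) B f(2) by (intro integrableI_bounded_set[of K _ _ B]) auto
qed

section \<open>Local finiteness of the volume measure and integrability of compactly supported
  functions\<close>

context horizontal_frame
begin

lemma sets_meas [measurable_cong]: "sets \<mu> = sets borel"
  using meas by (simp add: volume_measure_def)

text \<open>The set \<open>B\<close> is a closed coordinate ball: the continuous density
  \<open>w c\<close> is bounded on it, and Lebesgue measure of a ball is finite. The set
  \<open>U\<close> is the preimage of the open ball.\<close>

lemma compact_neighbourhood:
  assumes "open \<Omega>" "m \<in> \<Omega>"
  obtains U B where "open U" "m \<in> U" "U \<subseteq> B" "compact B" "B \<subseteq> \<Omega>" "emeasure \<mu> B < \<infinity>"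
proof -
  obtain c where c: "c \<in> A" "m \<in> fst c" by (rule chart_around)
  let ?V = "snd c ` (fst c \<inter> \<Omega>)"
  have "open ?V" using c assms chart_domain_open by (intro chart_image_open_subset open_Int) auto
  moreover have "snd c m \<in> ?V" using c assms by blast
  ultimately obtain e where e: "e > 0" "cball (snd c m) e \<subseteq> ?V"
    using open_contains_cball by blast
  define B where "B = chart_inv c ` cball (snd c m) e"
  have sub: "cball (snd c m) e \<subseteq> snd c ` fst c" using e by blast
  have cont: "continuous_on (snd c ` fst c) (chart_inv c)"
    using homeomorphism_cont2[OF chart_homeomorphism[OF c(1)]] .
  have cpt: "compact B" unfolding B_def
    using continuous_on_subset[OF cont sub] by (intro compact_continuous_image) auto
  have B_sub: "B \<subseteq> fst c \<inter> \<Omega>"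
  proof
    fix x assume "x \<in> B"
    then obtain y where "y \<in> ?V" "x = chart_inv c y" unfolding B_def using e by blast
    then show "x \<in> fst c \<inter> \<Omega>" using chart_inv_chart[OF c(1)] by auto
  qed
  have img: "snd c ` B = cball (snd c m) e"
    unfolding B_def image_image
    using sub homeomorphism_apply2[OF chart_homeomorphism[OF c(1)]] by (force simp: subset_iff)
  have "continuous_on (snd c ` fst c) (w c)"
    using vol c(1) unfolding volume_form_def smooth_on_def by (metis Ck_on.simps(1))
  then have cont_w: "continuous_on (cball (snd c m) e) (w c)"
    using sub continuous_on_subset by blast
  have "\<exists>C. \<forall>y\<in>cball (snd c m) e. \<bar>w c y\<bar> \<le> C"
    using compact_imp_bounded[OF compact_continuous_image[OF cont_w compact_cball]]
    by (simp add: bounded_iff)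
  then obtain C where C: "\<And>y. y \<in> cball (snd c m) e \<Longrightarrow> \<bar>w c y\<bar> \<le> C" by blast
  have "emeasure \<mu> B = (\<integral>\<^sup>+y\<in>snd c ` B. ennreal \<bar>w c y\<bar> \<partial>lborel)"
    using meas c(1) B_sub compact_imp_closed[OF cpt] unfolding volume_measure_def by auto
  also have "\<dots> \<le> (\<integral>\<^sup>+y. ennreal C * indicator (cball (snd c m) e) y \<partial>lborel)"
    unfolding img by (intro nn_integral_mono) (auto simp: indicator_def intro!: ennreal_leI C)
  also have "\<dots> = ennreal C * emeasure lborel (cball (snd c m) e)"
    by (simp add: nn_integral_cmult_indicator)
  also have "\<dots> < \<infinity>"
    using emeasure_lborel_cball_finite[of "snd c m" e] by (simp add: ennreal_mult_less_top)
  finally have fin: "emeasure \<mu> B < \<infinity>" .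
  define U where "U = fst c \<inter> snd c -` ball (snd c m) e"
  have "open U" unfolding U_def
    using chart_continuous[OF c(1)] chart_domain_open[OF c(1)] continuous_on_open_vimage
    by (metis Int_commute open_ball)
  moreover have "m \<in> U" using c e by (simp add: U_def)
  moreover have "U \<subseteq> B"
  proof
    fix x assume "x \<in> U"
    then have "x \<in> fst c" "snd c x \<in> cball (snd c m) e" by (auto simp: U_def)
    then show "x \<in> B" unfolding B_def using chart_inv_chart[OF c(1)] by (metis image_eqI)
  qed
  ultimately show thesis using that cpt B_sub fin by blast
qed

text \<open>The defining formula of the measure speaks only of sets inside a single chart domain. A
  compact set may leave every chart, so it is covered by finitely many of the neighbourhoods
  above.\<close>

lemma compact_emeasure_finite:
  assumes "compact K"
  shows "emeasure \<mu> K < \<infinity>"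
proof -
  let ?C = "{U. open U \<and> (\<exists>B. U \<subseteq> B \<and> compact B \<and> emeasure \<mu> B < \<infinity>)}"
  have "K \<subseteq> \<Union>?C"
    using compact_neighbourhood[OF open_UNIV] by (smt (verit) UNIV_I UnionI mem_Collect_eq subsetI)
  then obtain D where D: "D \<subseteq> ?C" "finite D" "K \<subseteq> \<Union>D"
    using compactE[OF assms, of ?C] by blast
  then have sets: "D \<subseteq> sets \<mu>" using sets_meas by auto
  have "emeasure \<mu> U < \<infinity>" if "U \<in> D" for U
  proof -
    from that D obtain B where "U \<subseteq> B" "compact B" "emeasure \<mu> B < \<infinity>" by blast
    then show ?thesis
      using emeasure_mono[of U B \<mu>] compact_imp_closed[of B] sets_meas
      by (auto intro: order_le_less_trans)
  qed
  then have "(\<Sum>U\<in>D. emeasure \<mu> U) < \<infinity>"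
    using D(2) by (simp add: ennreal_sum_less_top)
  moreover have "emeasure \<mu> (\<Union>D) \<le> (\<Sum>U\<in>D. emeasure \<mu> U)"
    using emeasure_subadditive_finite[OF D(2), of "\<lambda>U. U"] sets by simp
  moreover have "emeasure \<mu> K \<le> emeasure \<mu> (\<Union>D)"
    using D(3) sets D(2) by (intro emeasure_mono sets.finite_Union) auto
  ultimately show ?thesis by (meson le_less_trans)
qed

text \<open>Second countability enters through Lindelof's theorem: countably many compact
  neighbourhoods cover the open set, and \<open>K n\<close> is the union of those with index below
  \<open>n\<close>.\<close>

lemma open_compact_exhaustion:
  assumes "open \<Omega>"
  obtains K :: "nat \<Rightarrow> 'm set" where "\<And>i. compact (K i)" "incseq K" "(\<Union>i. K i) = \<Omega>"
proof -
  let ?C = "{U. open U \<and> (\<exists>B. U \<subseteq> B \<and> compact B \<and> B \<subseteq> \<Omega>)}"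
  have "\<Omega> \<subseteq> \<Union>?C"
    using compact_neighbourhood[OF assms] by (smt (verit) UnionI mem_Collect_eq subsetI)
  moreover obtain D where D: "D \<subseteq> ?C" "countable D" "\<Union>D = \<Union>?C"
    using Lindelof[of ?C] by blast
  ultimately have cov: "\<Omega> \<subseteq> \<Union>D" by simp
  have "\<forall>U\<in>D. \<exists>B. U \<subseteq> B \<and> compact B \<and> B \<subseteq> \<Omega>" using D(1) by blast
  then obtain b where b: "\<And>U. U \<in> D \<Longrightarrow> U \<subseteq> b U \<and> compact (b U) \<and> b U \<subseteq> \<Omega>" by metis
  define K where "K n = (\<Union>U\<in>{U\<in>D. to_nat_on D U < n}. b U)" for n
  show thesis
  proof
    show "compact (K n)" for n
    proof -
      have "finite {U\<in>D. to_nat_on D U < n}"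
        using D(2) inj_on_to_nat_on[OF D(2)]
        by (intro inj_on_finite[of "to_nat_on D" _ "{..<n}"]) (auto intro: inj_on_subset)
      then show ?thesis unfolding K_def using b by (intro compact_UN) auto
    qed
    show "incseq K" unfolding incseq_def K_def by fastforce
    show "(\<Union>i. K i) = \<Omega>"
    proof
      show "(\<Union>i. K i) \<subseteq> \<Omega>" unfolding K_def using b by blast
      show "\<Omega> \<subseteq> (\<Union>i. K i)"
      proof
        fix x assume "x \<in> \<Omega>"
        then obtain U where "U \<in> D" "x \<in> U" using cov by blast
        \<comment> \<open>The successor is due to the strict inequality in the definition of
          \<open>K\<close>.\<close>
        then have "x \<in> K (Suc (to_nat_on D U))" unfolding K_def using b by blast
        then show "x \<in> (\<Union>i. K i)" by blast
      qed
    qed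
  qed
qed

lemma borel_measurable_continuous:
  fixes f :: "'m \<Rightarrow> 'b::topological_space"
  shows "continuous_on UNIV f \<Longrightarrow> f \<in> borel_measurable \<mu>"
  using borel_measurable_continuous_onI measurable_cong_sets[OF sets_meas refl] by blast

lemma C01_measurable: "\<phi> \<in> C01 A \<Omega> \<Longrightarrow> \<phi> \<in> borel_measurable \<mu>"
  and C01_nabla_X_measurable: "\<phi> \<in> C01 A \<Omega> \<Longrightarrow> nabla_X A a \<phi> \<in> borel_measurable \<mu>"
  using C01_C1_fun C1_fun_continuous nabla_X_continuous borel_measurable_continuous by blast+

lemma C01_eq_0: "\<phi> \<in> C01 A \<Omega> \<Longrightarrow> m \<notin> closure {m. \<phi> m \<noteq> 0} \<Longrightarrow> \<phi> m = 0"
  using closure_subset[of "{m. \<phi> m \<noteq> 0}"] by blast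

lemma C01_nabla_X_eq_0: "\<phi> \<in> C01 A \<Omega> \<Longrightarrow> m \<notin> closure {m. \<phi> m \<noteq> 0} \<Longrightarrow> nabla_X A a \<phi> m = 0"
  using C01_C1_fun nabla_X_eq_0 by blast

text \<open>The condition \<open>h 0 0 = 0\<close> passes the compact support from \<phi> to the
  integrand, since \<phi> and its gradient both vanish off that support. A continuous integrand is
  bounded there, and the support has finite measure.\<close>

lemma C01_integrable:
  assumes \<phi>: "\<phi> \<in> C01 A \<Omega>" and h: "continuous_on UNIV (\<lambda>m. h (\<phi> m) (nabla_X A a \<phi> m))" "h 0 0 = 0"
  shows "integrable \<mu> (\<lambda>m. h (\<phi> m) (nabla_X A a \<phi> m) :: real)"
proof (rule integrable_compactly_supported[OF sets_meas _ _ h(1)])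
  show "compact (closure {m. \<phi> m \<noteq> 0})" using \<phi> by (simp add: C01_def)
  then show "emeasure \<mu> (closure {m. \<phi> m \<noteq> 0}) < \<infinity>" by (rule compact_emeasure_finite)
  show "h (\<phi> m) (nabla_X A a \<phi> m) = 0" if "m \<notin> closure {m. \<phi> m \<noteq> 0}" for m
    unfolding C01_eq_0[OF \<phi> that] C01_nabla_X_eq_0[OF \<phi> that] by (rule h(2))
qed

lemma C01_powr_integrable:
  assumes "\<phi> \<in> C01 A \<Omega>" "0 < p"
  shows "integrable \<mu> (\<lambda>m. \<bar>\<phi> m\<bar> powr p)" "integrable \<mu> (\<lambda>m. norm (nabla_X A a \<phi> m) powr p)"
proof -
  have "continuous_on UNIV (\<lambda>m. \<bar>\<phi> m\<bar> powr p)"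
    "continuous_on UNIV (\<lambda>m. norm (nabla_X A a \<phi> m) powr p)"
    using assms(2) C1_fun_continuous[OF C01_C1_fun[OF assms(1)]]
      nabla_X_continuous[OF C01_C1_fun[OF assms(1)]]
    by (auto intro!: continuous_on_powr' continuous_on_rabs continuous_on_norm)
  then show "integrable \<mu> (\<lambda>m. \<bar>\<phi> m\<bar> powr p)"
    "integrable \<mu> (\<lambda>m. norm (nabla_X A a \<phi> m) powr p)"
    using C01_integrable[OF assms(1), of "\<lambda>x y. \<bar>x\<bar> powr p"]
      C01_integrable[OF assms(1), of "\<lambda>x y. norm y powr p"] by auto
qed

lemma C01_support_subset:
  assumes \<phi>: "\<phi> \<in> C01 A \<Omega>" and u: "C1_fun A u" "\<And>m. \<phi> m = 0 \<Longrightarrow> u m = 0"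
  shows "u \<in> C01 A \<Omega>"
proof -
  have sub: "closure {m. u m \<noteq> 0} \<subseteq> closure {m. \<phi> m \<noteq> 0}"
    using u(2) by (intro closure_mono) auto
  moreover have \<phi>': "compact (closure {m. \<phi> m \<noteq> 0})" "closure {m. \<phi> m \<noteq> 0} \<subseteq> \<Omega>"
    using \<phi> by (auto simp: C01_def)
  moreover have "compact (closure {m. u m \<noteq> 0})"
    using compact_Int_closed[OF \<phi>'(1) closed_closure, of "{m. u m \<noteq> 0}"] sub
    by (simp add: Int_absorb1)
  ultimately show ?thesis
    using u(1) unfolding C01_def C1_fun_def by blast
qed

end

section \<open>The completion\<close>

lemma nn_integral_norm_tendsto_0:
  fixes h :: "nat \<Rightarrow> 'a \<Rightarrow> 'b::{real_normed_vector, second_countable_topology}"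
  assumes [measurable]: "\<And>i. h i \<in> borel_measurable M" and w: "integrable M w"
    and "\<And>i m. norm (h i m) \<le> w m" "AE m in M. (\<lambda>i. h i m) \<longlonglongrightarrow> 0"
  shows "(\<lambda>i. \<integral>\<^sup>+m. ennreal (norm (h i m)) \<partial>M) \<longlonglongrightarrow> 0"
proof -
  have w0: "0 \<le> w m" for m using assms(3) norm_ge_zero order_trans by blast
  have "(\<lambda>i. \<integral>\<^sup>+m. ennreal (norm (h i m)) \<partial>M) \<longlonglongrightarrow> (\<integral>\<^sup>+m. 0 \<partial>M)"
  proof (rule nn_integral_dominated_convergence[where w = "\<lambda>m. ennreal (w m)"])
    show "(\<integral>\<^sup>+m. ennreal (w m) \<partial>M) < \<infinity>"
      using nn_integral_eq_integral[OF w] w0 by simp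
    show "AE m in M. (\<lambda>i. ennreal (norm (h i m))) \<longlonglongrightarrow> 0"
      using assms(4)
    proof eventually_elim
      fix m assume "(\<lambda>i. h i m) \<longlonglongrightarrow> 0"
      then have "(\<lambda>i. ennreal (norm (h i m))) \<longlonglongrightarrow> ennreal 0"
        by (intro tendsto_ennrealI tendsto_norm_zero)
      then show "(\<lambda>i. ennreal (norm (h i m))) \<longlonglongrightarrow> 0" by simp
    qed
  qed (use assms(3) borel_measurable_integrable[OF w] in \<open>auto intro: ennreal_leI\<close>)
  then show ?thesis by simp
qed

lemma abs_add_powr_le:
  fixes x y :: real
  assumes "1 \<le> p"
  shows "\<bar>x + y\<bar> powr p \<le> (1/2) powr (1 - p) * (\<bar>x\<bar> powr p + \<bar>y\<bar> powr p)"
  using norm_add_powr_le[OF assms, of "1/2" x y] by (simp add: distrib_left)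

section \<open>Representatives, scaling, products and limits in the completion\<close>

context horizontal_frame
begin

text \<open>Measurability is required in \<open>S0_grad\<close> only relative to \<Omega>. Extension
  by zero gives Borel functions on the whole manifold, and it is invisible to the definition, whose
  integrals all run over subsets of \<Omega>.\<close>

lemma S0_grad_zero_extension:
  assumes "S0_grad A a \<mu> p \<Omega> u G"
  shows "S0_grad A a \<mu> p \<Omega> (\<lambda>m. indicator \<Omega> m *\<^sub>R u m) (\<lambda>m. indicator \<Omega> m *\<^sub>R G m)"
proof -
  have ind: "indicator \<Omega> m *\<^sub>R indicator \<Omega> m *\<^sub>R x = (indicator \<Omega> m *\<^sub>R x :: 'b::real_vector)" for m x
    by (simp add: indicator_def)
  have "(\<integral>\<^sup>+m\<in>K. ennreal \<bar>f m - indicator \<Omega> m *\<^sub>R u m\<bar> \<partial>\<mu>) = (\<integral>\<^sup>+m\<in>K. ennreal \<bar>f m - u m\<bar> \<partial>\<mu>)"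
    if "K \<subseteq> \<Omega>" for K and f :: "'m \<Rightarrow> real"
    using that by (intro nn_integral_cong) (auto simp: indicator_def)
  moreover have "(\<integral>\<^sup>+m\<in>\<Omega>. ennreal (norm (f m - indicator \<Omega> m *\<^sub>R G m) powr p) \<partial>\<mu>) =
      (\<integral>\<^sup>+m\<in>\<Omega>. ennreal (norm (f m - G m) powr p) \<partial>\<mu>)" for f :: "'m \<Rightarrow> real ^ 'k"
    by (intro nn_integral_cong) (auto simp: indicator_def)
  ultimately show ?thesis
    using assms unfolding S0_grad_def set_borel_measurable_def ind by simp
qed

lemma S0_grad_measurable:
  assumes "S0_grad A a \<mu> p \<Omega> u G"
  shows "(\<lambda>m. indicator \<Omega> m *\<^sub>R u m) \<in> borel_measurable \<mu>"
    "(\<lambda>m. indicator \<Omega> m *\<^sub>R G m) \<in> borel_measurable \<mu>"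
  using assms unfolding S0_grad_def set_borel_measurable_def by auto

lemma S0_grad_approx:
  assumes "S0_grad A a \<mu> p \<Omega> u G"
  obtains f where "\<And>i::nat. f i \<in> C01 A \<Omega>"
    "\<And>K. compact K \<Longrightarrow> K \<subseteq> \<Omega> \<Longrightarrow> (\<lambda>i. \<integral>\<^sup>+m\<in>K. ennreal \<bar>f i m - u m\<bar> \<partial>\<mu>) \<longlonglongrightarrow> 0"
    "(\<lambda>i. \<integral>\<^sup>+m\<in>\<Omega>. ennreal (norm (nabla_X A a (f i) m - G m) powr p) \<partial>\<mu>) \<longlonglongrightarrow> 0"
  using assms unfolding S0_grad_def by blast

lemma S0_grad_scale:
  assumes S0: "S0_grad A a \<mu> p \<Omega> u G" and "open \<Omega>"
    and [measurable]: "u \<in> borel_measurable \<mu>" "G \<in> borel_measurable \<mu>"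
  shows "S0_grad A a \<mu> p \<Omega> (\<lambda>m. c * u m) (\<lambda>m. c *\<^sub>R G m)"
proof -
  have [measurable]: "\<Omega> \<in> sets \<mu>" using \<open>open \<Omega>\<close> sets_meas by simp
  obtain f where f: "\<And>i::nat. f i \<in> C01 A \<Omega>"
    "\<And>K. compact K \<Longrightarrow> K \<subseteq> \<Omega> \<Longrightarrow> (\<lambda>i. \<integral>\<^sup>+m\<in>K. ennreal \<bar>f i m - u m\<bar> \<partial>\<mu>) \<longlonglongrightarrow> 0"
    "(\<lambda>i. \<integral>\<^sup>+m\<in>\<Omega>. ennreal (norm (nabla_X A a (f i) m - G m) powr p) \<partial>\<mu>) \<longlonglongrightarrow> 0"
    using S0_grad_approx[OF S0] by blast
  note [measurable] = C01_measurable[OF f(1)] C01_nabla_X_measurable[OF f(1)]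
  have der: "((\<lambda>t. c * t) has_real_derivative c) (at t)" for t
    by (auto intro!: derivative_eq_intros)
  have nabla: "nabla_X A a (\<lambda>m. c * f i m) m = c *\<^sub>R nabla_X A a (f i) m" for i m
    by (rule nabla_X_compose[OF C01_C1_fun[OF f(1)] der]) simp
  have "(\<lambda>m. c * f i m) \<in> C01 A \<Omega>" for i
    by (rule C01_support_subset[OF f(1) C1_fun_compose[OF C01_C1_fun[OF f(1)] der]]) auto
  moreover have "(\<lambda>i. \<integral>\<^sup>+m\<in>K. ennreal \<bar>c * f i m - c * u m\<bar> \<partial>\<mu>) \<longlonglongrightarrow> 0"
    if K: "compact K" "K \<subseteq> \<Omega>" for K
  proof -
    have [measurable]: "K \<in> sets \<mu>" using compact_imp_closed[OF K(1)] sets_meas by simp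
    have "(\<integral>\<^sup>+m\<in>K. ennreal \<bar>c * f i m - c * u m\<bar> \<partial>\<mu>) =
        (\<integral>\<^sup>+m. ennreal \<bar>c\<bar> * (ennreal \<bar>f i m - u m\<bar> * indicator K m) \<partial>\<mu>)" for i
      by (intro nn_integral_cong)
        (simp add: right_diff_distrib[symmetric] abs_mult ennreal_mult mult.assoc)
    also have "\<dots> i = ennreal \<bar>c\<bar> * (\<integral>\<^sup>+m\<in>K. ennreal \<bar>f i m - u m\<bar> \<partial>\<mu>)" for i
      by (rule nn_integral_cmult) measurable
    finally show ?thesis
      using ennreal_tendsto_cmult[OF _ f(2)[OF K], of "ennreal \<bar>c\<bar>"] by simp
  qed
  moreover have "(\<integral>\<^sup>+m\<in>\<Omega>. ennreal (norm (c *\<^sub>R nabla_X A a (f i) m - c *\<^sub>R G m) powr p) \<partial>\<mu>) =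
      ennreal (\<bar>c\<bar> powr p) * (\<integral>\<^sup>+m\<in>\<Omega>. ennreal (norm (nabla_X A a (f i) m - G m) powr p) \<partial>\<mu>)" for i
    by (subst nn_integral_cmult[symmetric])
      (auto simp: scaleR_right_diff_distrib[symmetric] powr_mult ennreal_mult mult.assoc
        intro!: nn_integral_cong)
  then have "(\<lambda>i. \<integral>\<^sup>+m\<in>\<Omega>. ennreal (norm (nabla_X A a (\<lambda>m. c * f i m) m - c *\<^sub>R G m) powr p) \<partial>\<mu>) \<longlonglongrightarrow> 0"
    using ennreal_tendsto_cmult[OF _ f(3), of "ennreal (\<bar>c\<bar> powr p)"] by (simp add: nabla)
  moreover have "set_borel_measurable \<mu> \<Omega> (\<lambda>m. c * u m)" "set_borel_measurable \<mu> \<Omega> (\<lambda>m. c *\<^sub>R G m)"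
    unfolding set_borel_measurable_def by measurable
  ultimately show ?thesis
    unfolding S0_grad_def by (intro conjI exI[of _ "\<lambda>i m. c * f i m"]) auto
qed

text \<open>One approximant at finite distance from \<open>G\<close> is enough, because its own
  gradient is continuous with compact support and so has finite energy.\<close>

lemma S0_grad_powr_finite:
  assumes S0: "S0_grad A a \<mu> p \<Omega> u G" and "open \<Omega>" and p: "1 \<le> p"
    and [measurable]: "G \<in> borel_measurable \<mu>"
  shows "(\<integral>\<^sup>+m\<in>\<Omega>. ennreal (norm (G m) powr p) \<partial>\<mu>) < \<infinity>"
proof -
  have [measurable]: "\<Omega> \<in> sets \<mu>" using \<open>open \<Omega>\<close> sets_meas by simp
  obtain f where f: "\<And>i::nat. f i \<in> C01 A \<Omega>"
    "\<And>K. compact K \<Longrightarrow> K \<subseteq> \<Omega> \<Longrightarrow> (\<lambda>i. \<integral>\<^sup>+m\<in>K. ennreal \<bar>f i m - u m\<bar> \<partial>\<mu>) \<longlonglongrightarrow> 0"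
    "(\<lambda>i. \<integral>\<^sup>+m\<in>\<Omega>. ennreal (norm (nabla_X A a (f i) m - G m) powr p) \<partial>\<mu>) \<longlonglongrightarrow> 0"
    using S0_grad_approx[OF S0] by blast
  note [measurable] = C01_nabla_X_measurable[OF f(1)]
  obtain i where i: "(\<integral>\<^sup>+m\<in>\<Omega>. ennreal (norm (nabla_X A a (f i) m - G m) powr p) \<partial>\<mu>) < \<infinity>"
    using eventually_happens'[OF _ order_tendstoD(2)[OF f(3), of \<infinity>]] by auto
  have "(\<integral>\<^sup>+m\<in>\<Omega>. ennreal (norm (nabla_X A a (f i) m) powr p) \<partial>\<mu>) \<le>
      (\<integral>\<^sup>+m. ennreal (norm (nabla_X A a (f i) m) powr p) \<partial>\<mu>)"
    by (intro nn_integral_mono) (simp add: indicator_def)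
  also have "\<dots> < \<infinity>"
    using C01_powr_integrable(2)[OF f(1)[of i], of p] p by (simp add: nn_integral_eq_integral)
  finally have fin: "(\<integral>\<^sup>+m\<in>\<Omega>. ennreal (norm (nabla_X A a (f i) m) powr p) \<partial>\<mu>) < \<infinity>" .
  have "(\<integral>\<^sup>+m\<in>\<Omega>. ennreal (norm (nabla_X A a (f i) m + (G m - nabla_X A a (f i) m)) powr p) \<partial>\<mu>) \<le>
    ennreal ((1 - 1/2) powr (1 - p)) * (\<integral>\<^sup>+m\<in>\<Omega>. ennreal (norm (nabla_X A a (f i) m) powr p) \<partial>\<mu>) +
    ennreal ((1/2) powr (1 - p)) * (\<integral>\<^sup>+m\<in>\<Omega>. ennreal (norm (G m - nabla_X A a (f i) m) powr p) \<partial>\<mu>)"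
    using p by (intro nn_integral_powr_norm_add) auto
  also have "\<dots> < \<infinity>"
    using fin i by (simp add: norm_minus_commute ennreal_mult_less_top)
  finally show ?thesis by simp
qed

lemma C01_bounded:
  assumes \<phi>: "\<phi> \<in> C01 A \<Omega>"
  obtains B where "\<And>m. \<bar>\<phi> m\<bar> \<le> B" "0 \<le> B"
proof -
  have "compact (closure {m. \<phi> m \<noteq> 0})" using \<phi> by (simp add: C01_def)
  then have "bounded (\<phi> ` closure {m. \<phi> m \<noteq> 0})"
    using C1_fun_continuous[OF C01_C1_fun[OF \<phi>]]
    by (intro compact_imp_bounded compact_continuous_image) (auto intro: continuous_on_subset)
  then obtain B where "\<forall>m \<in> closure {m. \<phi> m \<noteq> 0}. \<bar>\<phi> m\<bar> \<le> B"
    by (auto simp: bounded_iff)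
  then have "\<bar>\<phi> m\<bar> \<le> max B 0" for m
    using C01_eq_0[OF \<phi>, of m] by (cases "m \<in> closure {m. \<phi> m \<noteq> 0}") (simp_all add: le_max_iff_disj)
  then show thesis by (rule that) simp
qed

text \<open>The product and chain rules hold for the approximants \<phi>\<open>* g (f i)\<close>,
  where \<open>f\<close> approximates \<open>v\<close>. The bounds on \<open>g\<close> and
  \<open>g'\<close> let them survive the limit. This is the source of the test functions in Picone's
  argument: \<phi> supplies the compact support, and convergence of \<open>f\<close> is needed only
  on it.\<close>

lemma S0_grad_mult_compose:
  assumes S0: "S0_grad A a \<mu> p \<Omega> v G" and "open \<Omega>" and p: "1 \<le> p"
    and [measurable]: "v \<in> borel_measurable \<mu>" "G \<in> borel_measurable \<mu>"
    and \<phi>: "\<phi> \<in> C01 A \<Omega>"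
    and g: "\<And>t. (g has_real_derivative g' t) (at t)" "continuous_on UNIV g'"
      "\<And>t. \<bar>g t\<bar> \<le> B" "\<And>t. \<bar>g' t\<bar> \<le> B"
  shows "S0_grad A a \<mu> p \<Omega> (\<lambda>m. \<phi> m * g (v m))
    (\<lambda>m. g (v m) *\<^sub>R nabla_X A a \<phi> m + (\<phi> m * g' (v m)) *\<^sub>R G m)"
proof -
  let ?\<Gamma> = "\<lambda>m. g (v m) *\<^sub>R nabla_X A a \<phi> m + (\<phi> m * g' (v m)) *\<^sub>R G m"
  have [measurable]: "\<Omega> \<in> sets \<mu>" using \<open>open \<Omega>\<close> sets_meas by simp
  have B: "0 \<le> B" using g(3)[of 0] by linarith
  have cont_g: "continuous_on UNIV g"
    using g(1) DERIV_isCont continuous_at_imp_continuous_on by blast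
  note [measurable] = borel_measurable_continuous_onI[OF cont_g]
    borel_measurable_continuous_onI[OF g(2)] C01_measurable[OF \<phi>] C01_nabla_X_measurable[OF \<phi>]
  obtain C where C: "\<And>m. \<bar>\<phi> m\<bar> \<le> C" "0 \<le> C" using C01_bounded[OF \<phi>] by blast
  define K where "K = closure {m. \<phi> m \<noteq> 0}"
  have K: "compact K" "K \<subseteq> \<Omega>" using \<phi> by (simp_all add: C01_def K_def)
  have [measurable]: "K \<in> sets \<mu>" using compact_imp_closed[OF K(1)] sets_meas by simp
  have off_K: "\<phi> m = 0" "nabla_X A a \<phi> m = 0" if "m \<notin> K" for m
    using C01_eq_0[OF \<phi>] C01_nabla_X_eq_0[OF \<phi>] that unfolding K_def by blast+
  obtain f where f: "\<And>i::nat. f i \<in> C01 A \<Omega>"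
    "\<And>K. compact K \<Longrightarrow> K \<subseteq> \<Omega> \<Longrightarrow> (\<lambda>i. \<integral>\<^sup>+m\<in>K. ennreal \<bar>f i m - v m\<bar> \<partial>\<mu>) \<longlonglongrightarrow> 0"
    "(\<lambda>i. \<integral>\<^sup>+m\<in>\<Omega>. ennreal (norm (nabla_X A a (f i) m - G m) powr p) \<partial>\<mu>) \<longlonglongrightarrow> 0"
    using S0_grad_approx[OF S0] by blast
  note [measurable] = C01_measurable[OF f(1)] C01_nabla_X_measurable[OF f(1)]
  \<comment> \<open>Convergence in \<open>L1\<close> on \<open>K\<close> does not give pointwise
    convergence of \<open>g (f i)\<close> and \<open>g' (f i)\<close>; an almost everywhere
    convergent subsequence does, by continuity of \<open>g\<close> and \<open>g'\<close>.\<close>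
  obtain r where r: "strict_mono r" "AE m in \<mu>. m \<in> K \<longrightarrow> (\<lambda>i. f (r i) m) \<longlonglongrightarrow> v m"
    using AE_subseq_of_nn_integral_tendsto_0[OF _ _ _ f(2)[OF K]] by auto
  define h where "h i m = \<phi> m * g (f (r i) m)" for i m
  have C1: "C1_fun A (\<lambda>m. g (f (r i) m))" for i
    using C1_fun_compose[OF C01_C1_fun[OF f(1)] g(1,2)] .
  have h_C01: "h i \<in> C01 A \<Omega>" for i
    unfolding h_def by (rule C01_support_subset[OF \<phi> C1_fun_mult[OF C01_C1_fun[OF \<phi>] C1]]) simp
  have nabla_h: "nabla_X A a (h i) m =
      \<phi> m *\<^sub>R g' (f (r i) m) *\<^sub>R nabla_X A a (f (r i)) m + g (f (r i) m) *\<^sub>R nabla_X A a \<phi> m" for i m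
    unfolding h_def nabla_X_mult[OF C01_C1_fun[OF \<phi>] C1]
      nabla_X_compose[OF C01_C1_fun[OF f(1)] g(1,2)] ..
  \<comment> \<open>The error of the gradient is split by cause. In \<open>D\<close> only the
    coefficients differ while the gradient of \<phi> and \<open>G\<close> are fixed, so dominated
    convergence applies. In \<open>E\<close> a coefficient bounded by \<open>C * B\<close>
    multiplies the gradient error of \<open>f\<close>, which tends to 0 in the \<open>p\<close>-th
    mean by assumption.\<close>
  define D where "D i m = (g (f (r i) m) - g (v m)) *\<^sub>R nabla_X A a \<phi> m +
      (\<phi> m * (g' (f (r i) m) - g' (v m))) *\<^sub>R G m" for i m
  define E where "E i m = (\<phi> m * g' (f (r i) m)) *\<^sub>R (nabla_X A a (f (r i)) m - G m)" for i m
  have DE: "nabla_X A a (h i) m - ?\<Gamma> m = D i m + E i m" for i m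
    unfolding nabla_h D_def E_def by (simp add: algebra_simps)
  have [measurable]: "D i \<in> borel_measurable \<mu>" "E i \<in> borel_measurable \<mu>" for i
    unfolding D_def E_def by measurable
  have diff: "\<bar>g s - g t\<bar> \<le> 2 * B" "\<bar>g' s - g' t\<bar> \<le> 2 * B" for s t
    using g(3)[of s] g(3)[of t] g(4)[of s] g(4)[of t] by linarith+
  have conv: "AE m in \<mu>. m \<in> K \<longrightarrow>
      (\<lambda>i. g (f (r i) m)) \<longlonglongrightarrow> g (v m) \<and> (\<lambda>i. g' (f (r i) m)) \<longlonglongrightarrow> g' (v m)"
    using r(2) by eventually_elim
      (auto intro: continuous_on_tendsto_compose[OF cont_g] continuous_on_tendsto_compose[OF g(2)])

  have lim_h: "(\<lambda>i. \<integral>\<^sup>+m. ennreal (norm (h i m - \<phi> m * g (v m))) \<partial>\<mu>) \<longlonglongrightarrow> 0"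
  proof (rule nn_integral_norm_tendsto_0[where w = "\<lambda>m. 2 * B * \<bar>\<phi> m\<bar>"])
    show "integrable \<mu> (\<lambda>m. 2 * B * \<bar>\<phi> m\<bar>)"
      using C01_powr_integrable(1)[OF \<phi>, of 1] by simp
    show "norm (h i m - \<phi> m * g (v m)) \<le> 2 * B * \<bar>\<phi> m\<bar>" for i m
      using mult_right_mono[OF diff(1)[of "f (r i) m" "v m"], of "\<bar>\<phi> m\<bar>"]
      by (simp add: h_def right_diff_distrib[symmetric] abs_mult mult.commute)
    show "AE m in \<mu>. (\<lambda>i. h i m - \<phi> m * g (v m)) \<longlonglongrightarrow> 0"
      using conv
    proof eventually_elim
      case (elim m)
      show ?case
      proof (cases "m \<in> K")
        case True
        then have "(\<lambda>i. \<phi> m * g (f (r i) m) - \<phi> m * g (v m)) \<longlonglongrightarrow> \<phi> m * g (v m) - \<phi> m * g (v m)"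
          using elim by (intro tendsto_intros) auto
        then show ?thesis by (simp add: h_def)
      qed (simp add: h_def off_K)
    qed
  qed (unfold h_def, measurable)
  have "(\<lambda>i. \<integral>\<^sup>+m\<in>L. ennreal \<bar>h i m - \<phi> m * g (v m)\<bar> \<partial>\<mu>) \<longlonglongrightarrow> 0" for L
    by (rule tendsto_sandwich[OF _ _ tendsto_const lim_h])
      (auto intro!: always_eventually nn_integral_mono simp: indicator_def)
  moreover have "(\<lambda>i. \<integral>\<^sup>+m\<in>\<Omega>. ennreal (norm (nabla_X A a (h i) m - ?\<Gamma> m) powr p) \<partial>\<mu>) \<longlonglongrightarrow> 0"
  proof -
    \<comment> \<open>The outer factor is that of \<open>abs_add_powr_le\<close>;
      \<open>2 * B\<close> bounds differences of values of \<open>g\<close> or \<open>g'\<close>,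
      and \<open>C\<close> bounds \<phi>.\<close>
    let ?w = "\<lambda>m. (1/2) powr (1 - p) * ((2 * B) powr p * norm (nabla_X A a \<phi> m) powr p +
        (2 * B * C) powr p * (indicator \<Omega> m * norm (G m) powr p))"
    have "(\<lambda>i. \<integral>\<^sup>+m. ennreal (norm (indicator \<Omega> m * norm (D i m) powr p)) \<partial>\<mu>) \<longlonglongrightarrow> 0"
    proof (rule nn_integral_norm_tendsto_0[where w = ?w])
      have "integrable \<mu> (\<lambda>m. indicator \<Omega> m * norm (G m) powr p)"
      proof (rule integrableI_bounded)
        have "(\<integral>\<^sup>+m. ennreal (norm (indicator \<Omega> m * norm (G m) powr p)) \<partial>\<mu>) =
          (\<integral>\<^sup>+m\<in>\<Omega>. ennreal (norm (G m) powr p) \<partial>\<mu>)"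
          by (intro nn_integral_cong) (simp add: indicator_def)
        then show "(\<integral>\<^sup>+m. ennreal (norm (indicator \<Omega> m * norm (G m) powr p)) \<partial>\<mu>) < \<infinity>"
          using S0_grad_powr_finite[OF S0 \<open>open \<Omega>\<close> p] by simp
      qed measurable
      then show "integrable \<mu> ?w"
        using C01_powr_integrable(2)[OF \<phi>, of p] p
        by (intro integrable_mult_right Bochner_Integration.integrable_add) auto
      show "norm (indicator \<Omega> m * norm (D i m) powr p) \<le> ?w m" for i m
      proof (cases "m \<in> \<Omega>")
        case True
        have "norm (D i m) \<le> \<bar>g (f (r i) m) - g (v m)\<bar> * norm (nabla_X A a \<phi> m) +
            \<bar>\<phi> m\<bar> * \<bar>g' (f (r i) m) - g' (v m)\<bar> * norm (G m)"
          unfolding D_def by (rule order_trans[OF norm_triangle_ineq]) (simp add: abs_mult)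
        also have "\<dots> \<le> 2 * B * norm (nabla_X A a \<phi> m) + C * (2 * B) * norm (G m)"
          using C B diff by (intro add_mono mult_mono) auto
        finally have "norm (D i m) powr p \<le>
            \<bar>2 * B * norm (nabla_X A a \<phi> m) + 2 * B * C * norm (G m)\<bar> powr p"
          using p by (intro powr_mono2) (auto simp: mult_ac)
        also have "\<dots> \<le> (1/2) powr (1 - p) * (\<bar>2 * B * norm (nabla_X A a \<phi> m)\<bar> powr p +
            \<bar>2 * B * C * norm (G m)\<bar> powr p)"
          by (rule abs_add_powr_le[OF p])
        also have "\<dots> = ?w m"
          using True B C by (simp add: powr_mult abs_mult)
        finally show ?thesis using True by simp
      qed simp
      show "AE m in \<mu>. (\<lambda>i. indicator \<Omega> m * norm (D i m) powr p) \<longlonglongrightarrow> 0"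
        using conv
      proof eventually_elim
        case (elim m)
        have "(\<lambda>i. D i m) \<longlonglongrightarrow> 0"
        proof (cases "m \<in> K")
          case True
          then have "(\<lambda>i. D i m) \<longlonglongrightarrow> (g (v m) - g (v m)) *\<^sub>R nabla_X A a \<phi> m +
              (\<phi> m * (g' (v m) - g' (v m))) *\<^sub>R G m"
            unfolding D_def using elim by (intro tendsto_intros) auto
          then show ?thesis by simp
        qed (simp add: D_def off_K)
        then have "(\<lambda>i. indicator \<Omega> m * norm (D i m) powr p) \<longlonglongrightarrow> indicator \<Omega> m * 0 powr p"
          using p by (intro tendsto_intros tendsto_powr' tendsto_norm_zero) auto
        then show ?case by simp
      qed
    qed measurable
    moreover have "(\<integral>\<^sup>+m. ennreal (norm (indicator \<Omega> m * norm (D i m) powr p)) \<partial>\<mu>) =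
        (\<integral>\<^sup>+m\<in>\<Omega>. ennreal (norm (D i m) powr p) \<partial>\<mu>)" for i
      by (intro nn_integral_cong) (simp add: indicator_def)
    ultimately have D: "(\<lambda>i. \<integral>\<^sup>+m\<in>\<Omega>. ennreal (norm (D i m) powr p) \<partial>\<mu>) \<longlonglongrightarrow> 0" by simp
    let ?e = "\<lambda>i. \<integral>\<^sup>+m\<in>\<Omega>. ennreal (norm (nabla_X A a (f i) m - G m) powr p) \<partial>\<mu>"
    have E_le: "(\<integral>\<^sup>+m\<in>\<Omega>. ennreal (norm (E i m) powr p) \<partial>\<mu>) \<le> ennreal ((C * B) powr p) * ?e (r i)" for i
    proof -
      have "norm (E i m) powr p \<le> (C * B) powr p * norm (nabla_X A a (f (r i)) m - G m) powr p" for m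
      proof -
        have "norm (E i m) \<le> C * B * norm (nabla_X A a (f (r i)) m - G m)"
          unfolding E_def norm_scaleR abs_mult using C g(4) B by (intro mult_mono) auto
        then have "norm (E i m) powr p \<le> (C * B * norm (nabla_X A a (f (r i)) m - G m)) powr p"
          using p by (intro powr_mono2) auto
        then show ?thesis using C B by (simp add: powr_mult)
      qed
      then have "(\<integral>\<^sup>+m\<in>\<Omega>. ennreal (norm (E i m) powr p) \<partial>\<mu>) \<le> (\<integral>\<^sup>+m. ennreal ((C * B) powr p) *
          (ennreal (norm (nabla_X A a (f (r i)) m - G m) powr p) * indicator \<Omega> m) \<partial>\<mu>)"
        by (intro nn_integral_mono) (auto simp: indicator_def ennreal_mult[symmetric] intro!: ennreal_leI)
      then show ?thesis by (subst (asm) nn_integral_cmult) auto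
    qed
    have "(\<lambda>i. ?e (r i)) \<longlonglongrightarrow> 0"
      using LIMSEQ_subseq_LIMSEQ[OF f(3) r(1)] by (simp add: o_def)
    then have "(\<lambda>i. ennreal ((1 - 1/2) powr (1 - p)) * (\<integral>\<^sup>+m\<in>\<Omega>. ennreal (norm (D i m) powr p) \<partial>\<mu>) +
        ennreal ((1/2) powr (1 - p)) * (ennreal ((C * B) powr p) * ?e (r i))) \<longlonglongrightarrow>
        ennreal ((1 - 1/2) powr (1 - p)) * 0 + ennreal ((1/2) powr (1 - p)) * (ennreal ((C * B) powr p) * 0)"
      using D by (intro tendsto_add ennreal_tendsto_cmult) auto
    then have lim: "(\<lambda>i. ennreal ((1 - 1/2) powr (1 - p)) * (\<integral>\<^sup>+m\<in>\<Omega>. ennreal (norm (D i m) powr p) \<partial>\<mu>) +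
        ennreal ((1/2) powr (1 - p)) * (ennreal ((C * B) powr p) * ?e (r i))) \<longlonglongrightarrow> 0"
      by simp
    have "(\<integral>\<^sup>+m\<in>\<Omega>. ennreal (norm (nabla_X A a (h i) m - ?\<Gamma> m) powr p) \<partial>\<mu>) \<le>
        ennreal ((1 - 1/2) powr (1 - p)) * (\<integral>\<^sup>+m\<in>\<Omega>. ennreal (norm (D i m) powr p) \<partial>\<mu>) +
        ennreal ((1/2) powr (1 - p)) * (ennreal ((C * B) powr p) * ?e (r i))" for i
    proof -
      have "(\<integral>\<^sup>+m\<in>\<Omega>. ennreal (norm (D i m + E i m) powr p) \<partial>\<mu>) \<le>
          ennreal ((1 - 1/2) powr (1 - p)) * (\<integral>\<^sup>+m\<in>\<Omega>. ennreal (norm (D i m) powr p) \<partial>\<mu>) +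
          ennreal ((1/2) powr (1 - p)) * (\<integral>\<^sup>+m\<in>\<Omega>. ennreal (norm (E i m) powr p) \<partial>\<mu>)"
        using p by (intro nn_integral_powr_norm_add) auto
      then show ?thesis
        unfolding DE by (rule order_trans) (intro add_left_mono mult_left_mono E_le, simp)
    qed
    then show ?thesis
      by (intro tendsto_sandwich[OF _ _ tendsto_const lim] always_eventually) auto
  qed
  moreover have "set_borel_measurable \<mu> \<Omega> (\<lambda>m. \<phi> m * g (v m))" "set_borel_measurable \<mu> \<Omega> ?\<Gamma>"
    unfolding set_borel_measurable_def by measurable
  ultimately show ?thesis
    unfolding S0_grad_def using h_C01 by (intro conjI exI[of _ h]) auto
qed

text \<open>The left side is only lower semicontinuous along the approximation, which is the
  direction needed. The subsequence converging almost everywhere depends on the compact set, so the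
  bound is first proved on each compact set and then extended by monotone convergence.\<close>

lemma S0_grad_Poincare:
  assumes S0: "S0_grad A a \<mu> p \<Omega> u G" and "open \<Omega>" and p: "1 < p"
    and [measurable]: "u \<in> borel_measurable \<mu>" "G \<in> borel_measurable \<mu>"
    and C01: "\<And>\<phi>. \<phi> \<in> C01 A \<Omega> \<Longrightarrow> ennreal l * (\<integral>\<^sup>+m\<in>\<Omega>. ennreal (\<bar>\<phi> m\<bar> powr p) \<partial>\<mu>) \<le>
      (\<integral>\<^sup>+m\<in>\<Omega>. ennreal (norm (nabla_X A a \<phi> m) powr p) \<partial>\<mu>)"
  shows "ennreal l * (\<integral>\<^sup>+m\<in>\<Omega>. ennreal (\<bar>u m\<bar> powr p) \<partial>\<mu>) \<le>
    (\<integral>\<^sup>+m\<in>\<Omega>. ennreal (norm (G m) powr p) \<partial>\<mu>)"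
proof -
  let ?I = "\<integral>\<^sup>+m\<in>\<Omega>. ennreal (norm (G m) powr p) \<partial>\<mu>"
  have [measurable]: "\<Omega> \<in> sets \<mu>" using \<open>open \<Omega>\<close> sets_meas by simp
  obtain f where f: "\<And>i::nat. f i \<in> C01 A \<Omega>"
    "\<And>K. compact K \<Longrightarrow> K \<subseteq> \<Omega> \<Longrightarrow> (\<lambda>i. \<integral>\<^sup>+m\<in>K. ennreal \<bar>f i m - u m\<bar> \<partial>\<mu>) \<longlonglongrightarrow> 0"
    "(\<lambda>i. \<integral>\<^sup>+m\<in>\<Omega>. ennreal (norm (nabla_X A a (f i) m - G m) powr p) \<partial>\<mu>) \<longlonglongrightarrow> 0"
    using S0_grad_approx[OF S0] by blast
  note [measurable] = C01_measurable[OF f(1)] C01_nabla_X_measurable[OF f(1)]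
  let ?e = "\<lambda>i. \<integral>\<^sup>+m\<in>\<Omega>. ennreal (norm (nabla_X A a (f i) m - G m) powr p) \<partial>\<mu>"
  have compact: "ennreal l * (\<integral>\<^sup>+m\<in>K. ennreal (\<bar>u m\<bar> powr p) \<partial>\<mu>) \<le> ?I"
    if K: "compact K" "K \<subseteq> \<Omega>" for K
  proof -
    have [measurable]: "K \<in> sets \<mu>" using compact_imp_closed[OF K(1)] sets_meas by simp
    obtain r where r: "strict_mono r" "AE m in \<mu>. m \<in> K \<longrightarrow> (\<lambda>i. f (r i) m) \<longlonglongrightarrow> u m"
      using AE_subseq_of_nn_integral_tendsto_0[OF _ _ _ f(2)[OF K]] by auto
    let ?h = "\<lambda>i m. ennreal l * (ennreal (\<bar>f (r i) m\<bar> powr p) * indicator K m)"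
    have lim_h: "AE m in \<mu>. liminf (\<lambda>i. ?h i m) = ennreal l * (ennreal (\<bar>u m\<bar> powr p) * indicator K m)"
      using r(2)
    proof eventually_elim
      case (elim m)
      have "(\<lambda>i. ennreal (\<bar>f (r i) m\<bar> powr p)) \<longlonglongrightarrow> ennreal (\<bar>u m\<bar> powr p)" if "m \<in> K"
        using elim that p by (intro tendsto_ennrealI tendsto_powr' tendsto_rabs) auto
      then have "(\<lambda>i. ?h i m) \<longlonglongrightarrow> ennreal l * (ennreal (\<bar>u m\<bar> powr p) * indicator K m)"
        by (cases "m \<in> K") (auto intro: ennreal_tendsto_cmult)
      then show ?case by (rule lim_imp_Liminf[OF sequentially_bot])
    qed
    \<comment> \<open>The order of the limits matters: \<open>t powr (1 - p)\<close> blows up as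
      \<open>t\<close> tends to 0, but for fixed \<open>t\<close> it multiplies an error that
      vanishes with \<open>i\<close>. Only afterwards does \<open>t\<close> tend to 0.\<close>
    have bound: "ennreal l * (\<integral>\<^sup>+m\<in>K. ennreal (\<bar>u m\<bar> powr p) \<partial>\<mu>) \<le> ennreal ((1 - t) powr (1 - p)) * ?I"
      if t: "0 < t" "t < 1" for t
    proof -
      have h_le: "(\<integral>\<^sup>+m. ?h i m \<partial>\<mu>) \<le>
          ennreal ((1 - t) powr (1 - p)) * ?I + ennreal (t powr (1 - p)) * ?e (r i)" for i
      proof -
        have "(\<integral>\<^sup>+m. ?h i m \<partial>\<mu>) = ennreal l * (\<integral>\<^sup>+m\<in>K. ennreal (\<bar>f (r i) m\<bar> powr p) \<partial>\<mu>)"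
          by (rule nn_integral_cmult) measurable
        also have "\<dots> \<le> ennreal l * (\<integral>\<^sup>+m\<in>\<Omega>. ennreal (\<bar>f (r i) m\<bar> powr p) \<partial>\<mu>)"
          using K(2) by (intro mult_left_mono nn_integral_mono) (auto simp: indicator_def)
        also have "\<dots> \<le> (\<integral>\<^sup>+m\<in>\<Omega>. ennreal (norm (nabla_X A a (f (r i)) m) powr p) \<partial>\<mu>)"
          by (rule C01[OF f(1)])
        also have "\<dots> = (\<integral>\<^sup>+m\<in>\<Omega>. ennreal (norm (G m + (nabla_X A a (f (r i)) m - G m)) powr p) \<partial>\<mu>)"
          by simp
        also have "\<dots> \<le> ennreal ((1 - t) powr (1 - p)) * ?I + ennreal (t powr (1 - p)) * ?e (r i)"
          using p t by (intro nn_integral_powr_norm_add) auto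
        finally show ?thesis .
      qed
      have "(\<lambda>i. ?e (r i)) \<longlonglongrightarrow> 0"
        using LIMSEQ_subseq_LIMSEQ[OF f(3) r(1)] by (simp add: o_def)
      then have lim: "(\<lambda>i. ennreal ((1 - t) powr (1 - p)) * ?I + ennreal (t powr (1 - p)) * ?e (r i)) \<longlonglongrightarrow>
          ennreal ((1 - t) powr (1 - p)) * ?I + ennreal (t powr (1 - p)) * 0"
        by (intro tendsto_add ennreal_tendsto_cmult tendsto_const) auto
      have "ennreal l * (\<integral>\<^sup>+m\<in>K. ennreal (\<bar>u m\<bar> powr p) \<partial>\<mu>) =
          (\<integral>\<^sup>+m. ennreal l * (ennreal (\<bar>u m\<bar> powr p) * indicator K m) \<partial>\<mu>)"
        by (rule nn_integral_cmult[symmetric]) measurable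
      also have "\<dots> = (\<integral>\<^sup>+m. liminf (\<lambda>i. ?h i m) \<partial>\<mu>)"
        by (rule nn_integral_cong_AE) (use lim_h in eventually_elim, simp)
      also have "\<dots> \<le> liminf (\<lambda>i. \<integral>\<^sup>+m. ?h i m \<partial>\<mu>)"
        by (rule nn_integral_liminf) measurable
      also have "\<dots> \<le> liminf (\<lambda>i. ennreal ((1 - t) powr (1 - p)) * ?I + ennreal (t powr (1 - p)) * ?e (r i))"
        by (intro Liminf_mono always_eventually allI h_le)
      also have "\<dots> = ennreal ((1 - t) powr (1 - p)) * ?I"
        using lim_imp_Liminf[OF sequentially_bot lim] by simp
      finally show ?thesis .
    qed
    \<comment> \<open>The two successors keep \<open>s n\<close> strictly below 1 also for
      \<open>n = 0\<close>.\<close>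
    define s where "s n = inverse (real (Suc (Suc n)))" for n
    have s: "0 < s n" "s n < 1" for n by (simp_all add: s_def inverse_eq_divide)
    have "s \<longlonglongrightarrow> 0"
      unfolding s_def using LIMSEQ_Suc[OF LIMSEQ_inverse_real_of_nat] by simp
    then have "(\<lambda>n. (1 - s n) powr (1 - p)) \<longlonglongrightarrow> (1 - 0) powr (1 - p)"
      by (intro tendsto_intros) auto
    then have "(\<lambda>n. ennreal ((1 - s n) powr (1 - p))) \<longlonglongrightarrow> 1"
      using tendsto_ennrealI by fastforce
    then have "(\<lambda>n. ?I * ennreal ((1 - s n) powr (1 - p))) \<longlonglongrightarrow> ?I * 1"
      using S0_grad_powr_finite[OF S0 \<open>open \<Omega>\<close>] p by (intro ennreal_tendsto_cmult) auto
    then have "(\<lambda>n. ennreal ((1 - s n) powr (1 - p)) * ?I) \<longlonglongrightarrow> ?I"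
      by (simp add: mult.commute)
    then show ?thesis
      using bound[OF s] by (intro LIMSEQ_le_const[of _ ?I]) auto
  qed
  obtain K :: "nat \<Rightarrow> 'm set" where K: "\<And>i. compact (K i)" "incseq K" "(\<Union>i. K i) = \<Omega>"
    using open_compact_exhaustion[OF \<open>open \<Omega>\<close>] by blast
  have [measurable]: "K i \<in> sets \<mu>" for i using compact_imp_closed[OF K(1)] sets_meas by simp
  let ?k = "\<lambda>i m. ennreal l * (ennreal (\<bar>u m\<bar> powr p) * indicator (K i) m)"
  have inc: "incseq ?k"
    using incseqD[OF K(2)] by (auto simp: incseq_def le_fun_def indicator_def)
  have "(SUP i. ?k i m) = ennreal l * (ennreal (\<bar>u m\<bar> powr p) * indicator \<Omega> m)" for m
  proof (rule antisym)
    show "(SUP i. ?k i m) \<le> ennreal l * (ennreal (\<bar>u m\<bar> powr p) * indicator \<Omega> m)"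
      using K(3) by (intro SUP_least mult_left_mono) (auto simp: indicator_def)
    show "ennreal l * (ennreal (\<bar>u m\<bar> powr p) * indicator \<Omega> m) \<le> (SUP i. ?k i m)"
    proof (cases "m \<in> \<Omega>")
      case True
      then obtain j where "m \<in> K j" using K(3) by blast
      then show ?thesis using True by (intro SUP_upper2[of j]) auto
    qed simp
  qed
  then have "ennreal l * (\<integral>\<^sup>+m\<in>\<Omega>. ennreal (\<bar>u m\<bar> powr p) \<partial>\<mu>) = (\<integral>\<^sup>+m. (SUP i. ?k i m) \<partial>\<mu>)"
    by (simp add: nn_integral_cmult)
  also have "\<dots> = (SUP i. \<integral>\<^sup>+m. ?k i m \<partial>\<mu>)"
    by (rule nn_integral_monotone_convergence_SUP[OF inc]) measurable
  also have "\<dots> \<le> ?I"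
  proof (rule SUP_least)
    fix i
    have "K i \<subseteq> \<Omega>" using K(3) by blast
    then show "(\<integral>\<^sup>+m. ?k i m \<partial>\<mu>) \<le> ?I"
      using compact[OF K(1)] by (subst nn_integral_cmult) auto
  qed
  finally show ?thesis .
qed

end

section \<open>Picone inequality and the principal frequency\<close>

text \<open>The derivative is the usual \<open>p * \<bar>t\<bar> powr (p - 2) * t\<close>, written
  with positive and negative parts so that only the positive exponent \<open>p - 1\<close> occurs
  and continuity at 0 is visible. At 0 the difference quotient is bounded by
  \<open>\<bar>y\<bar> powr (p - 1)\<close>.\<close>

lemma DERIV_abs_powr:
  fixes p t :: real
  assumes p: "1 < p"
  shows "((\<lambda>t. \<bar>t\<bar> powr p) has_real_derivative
    p * (max t 0 powr (p - 1) - max (- t) 0 powr (p - 1))) (at t)"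
proof -
  consider "0 < t" | "t < 0" | "t = 0" by linarith
  then show ?thesis
  proof cases
    case 1
    have "((\<lambda>t. t powr p) has_real_derivative p * t powr (p - 1)) (at t)"
      by (rule has_real_derivative_powr[OF 1])
    then show ?thesis
      using 1 p has_field_derivative_transform_within_open[of "\<lambda>t. t powr p" _ t "{0<..}" "\<lambda>t. \<bar>t\<bar> powr p"]
      by simp
  next
    case 2
    have "((\<lambda>t. (- t) powr p) has_real_derivative p * (- t) powr (p - 1) * - 1) (at t)"
      by (rule DERIV_chain2[OF has_real_derivative_powr]) (use 2 in \<open>auto intro!: derivative_eq_intros\<close>)
    then show ?thesis
      using 2 p has_field_derivative_transform_within_open[of "\<lambda>t. (- t) powr p" _ t "{..<0}" "\<lambda>t. \<bar>t\<bar> powr p"]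
      by simp
  next
    case 3
    have "((\<lambda>y. \<bar>y\<bar> powr p / y) \<longlongrightarrow> 0) (at 0)"
    proof (rule Lim_null_comparison)
      show "\<forall>\<^sub>F y in at 0. norm (\<bar>y\<bar> powr p / y) \<le> \<bar>y\<bar> powr (p - 1)"
        by (auto simp: eventually_at_filter powr_diff abs_mult)
      have "((\<lambda>y::real. \<bar>y\<bar> powr (p - 1)) \<longlongrightarrow> \<bar>0\<bar> powr (p - 1)) (at 0)"
        using p by (intro tendsto_powr' tendsto_rabs tendsto_ident_at tendsto_const) auto
      then show "((\<lambda>y. \<bar>y\<bar> powr (p - 1)) \<longlongrightarrow> 0) (at (0::real))" by simp
    qed
    then show ?thesis using 3 p by (simp add: has_field_derivative_iff)
  qed
qed

lemma DERIV_If_le: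
  fixes f g :: "real \<Rightarrow> real"
  assumes "(f has_real_derivative D) (at x)" "(g has_real_derivative D) (at x)" "f x = g x"
  shows "((\<lambda>y. if y \<le> x then f y else g y) has_real_derivative D) (at x)"
proof -
  have "((\<lambda>y. if y \<le> x then (f y - f x) / (y - x) else (g y - g x) / (y - x)) \<longlongrightarrow> D) (at x)"
    using assms(1,2) unfolding has_field_derivative_iff
    by (intro filterlim_If) (auto elim: filterlim_mono)
  then show ?thesis
    unfolding has_field_derivative_iff
    by (rule Lim_transform_eventually) (use assms(3) in \<open>auto intro!: always_eventually\<close>)
qed

text \<open>
  The reflection for \<open>t < 0\<close> keeps the function and its derivative bounded and continuous on
  the whole line: the functions in \<open>C01\<close> approximating a positive function may be negative.
\<close>

definition shifted_powr :: "real \<Rightarrow> real \<Rightarrow> real \<Rightarrow> real" where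
  "shifted_powr p e t =
     (if t \<le> 0 then 2 * e powr (1 - p) - (e - t) powr (1 - p) else (t + e) powr (1 - p))"

text \<open>The graph is reflected through the point with coordinates 0 and
  \<open>e powr (1 - p)\<close>. Such a point reflection makes the derivative even, so the one-sided
  derivatives agree at 0 and one formula in \<open>\<bar>t\<bar>\<close> covers all cases.\<close>

lemma DERIV_shifted_powr:
  assumes e: "0 < e"
  shows "(shifted_powr p e has_real_derivative (1 - p) * (\<bar>t\<bar> + e) powr (- p)) (at t)"
proof -
  let ?f = "\<lambda>t. 2 * e powr (1 - p) - (e - t) powr (1 - p)" and ?g = "\<lambda>t. (t + e) powr (1 - p)"
  have f: "(?f has_real_derivative (1 - p) * (\<bar>t\<bar> + e) powr (- p)) (at t)" if "t \<le> 0" for t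
  proof -
    have "((\<lambda>t. (e - t) powr (1 - p)) has_real_derivative
        (1 - p) * (e - t) powr (1 - p - 1) * - 1) (at t)"
      by (rule DERIV_chain2[OF has_real_derivative_powr])
        (use e that in \<open>auto intro!: derivative_eq_intros\<close>)
    from DERIV_diff[OF DERIV_const this] show ?thesis using that by (simp add: add.commute)
  qed
  have g: "(?g has_real_derivative (1 - p) * (\<bar>t\<bar> + e) powr (- p)) (at t)" if "0 \<le> t" for t
  proof -
    have "((\<lambda>t. (t + e) powr (1 - p)) has_real_derivative
        (1 - p) * (t + e) powr (1 - p - 1) * 1) (at t)"
      by (rule DERIV_chain2[OF has_real_derivative_powr])
        (use e that in \<open>auto intro!: derivative_eq_intros\<close>)
    then show ?thesis using that by simp
  qed
  consider "t = 0" | "t < 0" | "0 < t" by linarith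
  then show ?thesis
  proof cases
    case 1
    then show ?thesis
      using DERIV_If_le[OF f[of 0] g[of 0]] by (simp add: shifted_powr_def[abs_def])
  next
    case 2
    then show ?thesis
      using has_field_derivative_transform_within_open[OF f, of t "{..<0}" "shifted_powr p e"]
      by (simp add: shifted_powr_def)
  next
    case 3
    then show ?thesis
      using has_field_derivative_transform_within_open[OF g, of t "{0<..}" "shifted_powr p e"]
      by (simp add: shifted_powr_def)
  qed
qed

lemma shifted_powr_pos: "0 < t \<Longrightarrow> shifted_powr p e t = (t + e) powr (1 - p)"
  by (simp add: shifted_powr_def)

lemma shifted_powr_bounded:
  assumes "0 < e" "1 < p"
  shows "\<bar>shifted_powr p e t\<bar> \<le> 2 * e powr (1 - p)"
proof -
  have "(\<bar>t\<bar> + e) powr (1 - p) \<le> e powr (1 - p)"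
    using assms by (intro powr_mono2') auto
  moreover have "0 \<le> (\<bar>t\<bar> + e) powr (1 - p)" by simp
  moreover have "shifted_powr p e t =
      (if t \<le> 0 then 2 * e powr (1 - p) - (\<bar>t\<bar> + e) powr (1 - p) else (\<bar>t\<bar> + e) powr (1 - p))"
    by (simp add: shifted_powr_def)
  ultimately show ?thesis by argo
qed

text \<open>Here \<open>x\<close> stands for the gradient of \<open>v\<close>, \<open>y\<close> for
  that of \<phi>, \<open>V\<close> for \<open>v + e\<close>, \<open>t\<close> for the value of
  \<phi> and \<open>q\<close> for the derivative of \<open>\<bar>t\<bar> powr p\<close>. The second
  argument of \<open>inner\<close> is then the gradient of the test function.\<close>

lemma Picone_pointwise:
  fixes x y :: "'a::real_inner"
  assumes p: "1 < p" and V: "0 < V" and q: "\<bar>q\<bar> \<le> p * \<bar>t\<bar> powr (p - 1)"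
  shows "norm x powr (p - 2) *
      inner x (V powr (1 - p) *\<^sub>R q *\<^sub>R y + (\<bar>t\<bar> powr p * ((1 - p) * V powr (- p))) *\<^sub>R x)
    \<le> norm y powr p"
proof -
  \<comment> \<open>With this ratio the mixed term is at most
    \<open>p * s powr (p - 1) * norm y\<close> and the other one equals
    \<open>- (p - 1) * s powr p\<close>, the two terms of \<open>Young_powr\<close>.\<close>
  define s where "s = \<bar>t\<bar> * norm x / V"
  \<comment> \<open>The convention \<open>0 powr b = 0\<close> makes this identity and the next hold
    at \<open>x = 0\<close> also for \<open>p < 2\<close>.\<close>
  have sq: "norm x powr (p - 2) * inner x x = norm x powr p"
    by (cases "x = 0") (simp_all add: powr_diff power2_norm_eq_inner[symmetric])
  have n1: "norm x powr (p - 2) * norm x = norm x powr (p - 1)"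
    by (cases "x = 0") (simp_all add: powr_diff power2_eq_square)
  have s1: "s powr (p - 1) = \<bar>t\<bar> powr (p - 1) * norm x powr (p - 1) * V powr (1 - p)"
    using V by (simp add: s_def powr_mult powr_divide powr_diff)
  have s0: "s powr p = \<bar>t\<bar> powr p * norm x powr p * V powr (- p)"
    using V by (simp add: s_def powr_mult powr_divide powr_minus_divide)
  have "q * inner x y \<le> (p * \<bar>t\<bar> powr (p - 1)) * (norm x * norm y)"
  proof -
    have "q * inner x y \<le> \<bar>q\<bar> * \<bar>inner x y\<bar>" by (metis abs_ge_self abs_mult)
    also have "\<dots> \<le> (p * \<bar>t\<bar> powr (p - 1)) * (norm x * norm y)"
      using p by (intro mult_mono q Cauchy_Schwarz_ineq2) auto
    finally show ?thesis .
  qed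
  then have "norm x powr (p - 2) * V powr (1 - p) * (q * inner x y) \<le>
      norm x powr (p - 2) * V powr (1 - p) * ((p * \<bar>t\<bar> powr (p - 1)) * (norm x * norm y))"
    by (intro mult_left_mono) auto
  also have "\<dots> = p * (\<bar>t\<bar> powr (p - 1) * (norm x powr (p - 2) * norm x) * V powr (1 - p)) * norm y"
    by (simp add: mult_ac)
  also have "\<dots> = p * s powr (p - 1) * norm y" by (simp add: n1 s1)
  also have "\<dots> \<le> (p - 1) * s powr p + norm y powr p"
    using V by (intro Young_powr p) (auto simp: s_def)
  finally have 1: "norm x powr (p - 2) * V powr (1 - p) * (q * inner x y) \<le>
      (p - 1) * s powr p + norm y powr p" .
  have "norm x powr (p - 2) *
      inner x (V powr (1 - p) *\<^sub>R q *\<^sub>R y + (\<bar>t\<bar> powr p * ((1 - p) * V powr (- p))) *\<^sub>R x) =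
      norm x powr (p - 2) * V powr (1 - p) * (q * inner x y) +
      (1 - p) * (\<bar>t\<bar> powr p * (norm x powr (p - 2) * inner x x) * V powr (- p))"
    by (simp add: inner_add_right algebra_simps)
  also have "\<dots> \<le> norm y powr p" using 1 unfolding sq s0 by (simp add: algebra_simps)
  finally show ?thesis .
qed

lemma nn_set_integral_eq_set_integral:
  fixes f :: "'a \<Rightarrow> real"
  assumes "set_integrable M S f" "\<And>m. 0 \<le> f m"
  shows "(\<integral>\<^sup>+m\<in>S. ennreal (f m) \<partial>M) = ennreal (LINT m:S|M. f m)"
  using assms unfolding set_integrable_def set_lebesgue_integral_def
  by (subst nn_integral_eq_integral[symmetric]) (auto intro!: nn_integral_cong simp: indicator_def)

lemma weak_eigen_eq_zero_extension:
  "weak_eigen_eq \<mu> p \<Omega> l (\<lambda>m. indicator \<Omega> m *\<^sub>R u m) (\<lambda>m. indicator \<Omega> m *\<^sub>R G m) \<phi> \<Phi> =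
   weak_eigen_eq \<mu> p \<Omega> l u G \<phi> \<Phi>"
proof -
  have "indicator \<Omega> m *\<^sub>R (\<bar>indicator \<Omega> m *\<^sub>R u m\<bar> powr (p - 2) * (indicator \<Omega> m *\<^sub>R u m) * \<phi> m) =
      indicator \<Omega> m *\<^sub>R (\<bar>u m\<bar> powr (p - 2) * u m * \<phi> m)"
    "indicator \<Omega> m *\<^sub>R (norm (indicator \<Omega> m *\<^sub>R G m) powr (p - 2) * inner (indicator \<Omega> m *\<^sub>R G m) (\<Phi> m)) =
      indicator \<Omega> m *\<^sub>R (norm (G m) powr (p - 2) * inner (G m) (\<Phi> m))" for m
    by (simp_all add: indicator_def)
  then show ?thesis
    unfolding weak_eigen_eq_def set_integrable_def set_lebesgue_integral_def by presburger
qed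

lemma set_lebesgue_integral_powr_zero_extension:
  fixes G :: "'a \<Rightarrow> 'b::real_normed_vector"
  shows "(LINT m:\<Omega>|\<mu>. norm (indicator \<Omega> m *\<^sub>R G m) powr p) = (LINT m:\<Omega>|\<mu>. norm (G m) powr p)"
  unfolding set_lebesgue_integral_def by (intro Bochner_Integration.integral_cong) (auto simp: indicator_def)

section \<open>Energy bounds from the eigenvalue equation\<close>

context horizontal_frame
begin

lemma C01_powr_set_integrable:
  assumes "\<phi> \<in> C01 A \<Omega>" "open \<Omega>" "0 < p"
  shows "set_integrable \<mu> \<Omega> (\<lambda>m. \<bar>\<phi> m\<bar> powr p)"
    "set_integrable \<mu> \<Omega> (\<lambda>m. norm (nabla_X A a \<phi> m) powr p)"
  unfolding set_integrable_def
  by (intro integrable_mult_indicator C01_powr_integrable[OF assms(1,3)];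
      use assms(2) sets_meas in simp)+

lemma C01_frequency_bound:
  assumes S0: "S0_grad A a \<mu> p \<Omega> v G" and "open \<Omega>" and p: "1 < p"
    and [measurable]: "v \<in> borel_measurable \<mu>" "G \<in> borel_measurable \<mu>"
    and pos: "AE m in \<mu>. m \<in> \<Omega> \<longrightarrow> 0 < v m"
    and eigen: "\<And>\<phi> \<Phi>. S0_grad A a \<mu> p \<Omega> \<phi> \<Phi> \<Longrightarrow> (AE m in \<mu>. m \<in> \<Omega> \<longrightarrow> \<phi> m \<ge> 0) \<Longrightarrow>
      weak_eigen_eq \<mu> p \<Omega> l v G \<phi> \<Phi>"
    and \<phi>: "\<phi> \<in> C01 A \<Omega>"
  shows "l * (LINT m:\<Omega>|\<mu>. \<bar>\<phi> m\<bar> powr p) \<le> (LINT m:\<Omega>|\<mu>. norm (nabla_X A a \<phi> m) powr p)"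
proof -
  have [measurable]: "\<Omega> \<in> sets \<mu>" using \<open>open \<Omega>\<close> sets_meas by simp
  note [measurable] = C01_measurable[OF \<phi>] C01_nabla_X_measurable[OF \<phi>]
  define q where "q t = p * (max t 0 powr (p - 1) - max (- t) 0 powr (p - 1))" for t
  have q: "((\<lambda>t. \<bar>t\<bar> powr p) has_real_derivative q t) (at t)" for t
    unfolding q_def by (rule DERIV_abs_powr[OF p])
  have q_cont: "continuous_on UNIV q"
    unfolding q_def using p
    by (intro continuous_on_mult continuous_on_diff continuous_on_powr' continuous_on_max
        continuous_on_minus continuous_on_id continuous_on_const) auto
  have q_abs: "\<bar>q t\<bar> \<le> p * \<bar>t\<bar> powr (p - 1)" for t
    using p by (auto simp: q_def abs_mult max_def)
  \<comment> \<open>As \<open>1 < p\<close>, the power is continuously differentiable even where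
    \<phi> changes sign, so it can serve as the compactly supported factor in
    \<open>S0_grad_mult_compose\<close>.\<close>
  have \<psi>: "(\<lambda>m. \<bar>\<phi> m\<bar> powr p) \<in> C01 A \<Omega>"
    by (rule C01_support_subset[OF \<phi> C1_fun_compose[OF C01_C1_fun[OF \<phi>] q q_cont]]) simp
  have nabla_\<psi>: "nabla_X A a (\<lambda>m. \<bar>\<phi> m\<bar> powr p) m = q (\<phi> m) *\<^sub>R nabla_X A a \<phi> m" for m
    by (rule nabla_X_compose[OF C01_C1_fun[OF \<phi>] q q_cont])
  have int: "set_integrable \<mu> \<Omega> (\<lambda>m. norm (nabla_X A a \<phi> m) powr p)"
    "set_integrable \<mu> \<Omega> (\<lambda>m. \<bar>\<phi> m\<bar> powr p)"
    using C01_powr_set_integrable[OF \<phi> \<open>open \<Omega>\<close>, of p] p by auto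
  define J where "J e = (LINT m:\<Omega>|\<mu>. \<bar>v m\<bar> powr (p - 2) * v m * (\<bar>\<phi> m\<bar> powr p * shifted_powr p e (v m)))"
    for e
  have le: "l * J e \<le> (LINT m:\<Omega>|\<mu>. norm (nabla_X A a \<phi> m) powr p)" if e: "0 < e" for e
  proof -
    \<comment> \<open>The sum of a bound for \<open>shifted_powr\<close> and one for its derivative,
      because \<open>S0_grad_mult_compose\<close> takes a common bound.\<close>
    let ?B = "2 * e powr (1 - p) + (p - 1) * e powr (- p)"
    have bounds: "\<bar>shifted_powr p e t\<bar> \<le> ?B" "\<bar>(1 - p) * (\<bar>t\<bar> + e) powr (- p)\<bar> \<le> ?B" for t
    proof -
      have "(\<bar>t\<bar> + e) powr (- p) \<le> e powr (- p)" using e p by (intro powr_mono2') auto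
      then have "\<bar>(1 - p) * (\<bar>t\<bar> + e) powr (- p)\<bar> \<le> (p - 1) * e powr (- p)"
        using p by (simp add: abs_mult)
      moreover have "0 \<le> (p - 1) * e powr (- p)" using p by simp
      ultimately show "\<bar>shifted_powr p e t\<bar> \<le> ?B" "\<bar>(1 - p) * (\<bar>t\<bar> + e) powr (- p)\<bar> \<le> ?B"
        using shifted_powr_bounded[OF e p, of t] powr_ge_zero[of e "1 - p"] by linarith+
    qed
    have cont: "continuous_on UNIV (\<lambda>t. (1 - p) * (\<bar>t\<bar> + e) powr (- p))"
      using e by (intro continuous_intros) (auto simp: add_nonneg_eq_0_iff)
    let ?\<Phi> = "\<lambda>m. shifted_powr p e (v m) *\<^sub>R q (\<phi> m) *\<^sub>R nabla_X A a \<phi> m +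
        (\<bar>\<phi> m\<bar> powr p * ((1 - p) * (\<bar>v m\<bar> + e) powr (- p))) *\<^sub>R G m"
    have "S0_grad A a \<mu> p \<Omega> (\<lambda>m. \<bar>\<phi> m\<bar> powr p * shifted_powr p e (v m)) ?\<Phi>"
      using S0_grad_mult_compose[OF S0 \<open>open \<Omega>\<close> _ _ _ \<psi> DERIV_shifted_powr[OF e] cont bounds] p
      by (simp add: nabla_\<psi>)
    moreover have "AE m in \<mu>. m \<in> \<Omega> \<longrightarrow> 0 \<le> \<bar>\<phi> m\<bar> powr p * shifted_powr p e (v m)"
      using pos by eventually_elim (simp add: shifted_powr_pos)
    ultimately have "weak_eigen_eq \<mu> p \<Omega> l v G (\<lambda>m. \<bar>\<phi> m\<bar> powr p * shifted_powr p e (v m)) ?\<Phi>"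
      by (rule eigen)
    then have "l * J e = (LINT m:\<Omega>|\<mu>. norm (G m) powr (p - 2) * inner (G m) (?\<Phi> m))"
      by (simp add: weak_eigen_eq_def J_def)
    also have "\<dots> \<le> (LINT m:\<Omega>|\<mu>. norm (nabla_X A a \<phi> m) powr p)"
      unfolding set_lebesgue_integral_def
    \<comment> \<open>The majorant is integrable and nonnegative, so the rule also covers a left
      integrand that is not integrable, whose integral is 0 by default.\<close>
    proof (rule integral_mono_AE')
      show "AE m in \<mu>. indicator \<Omega> m *\<^sub>R (norm (G m) powr (p - 2) * inner (G m) (?\<Phi> m))
          \<le> indicator \<Omega> m *\<^sub>R (norm (nabla_X A a \<phi> m) powr p)"
        using pos
      proof eventually_elim
        case (elim m)
        show ?case
        proof (cases "m \<in> \<Omega>")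
          case True
          then have "0 < v m" using elim by blast
          then show ?thesis
            using True e Picone_pointwise[OF p _ q_abs, of "v m + e" "G m" "\<phi> m" "nabla_X A a \<phi> m"]
            by (simp add: shifted_powr_pos)
        qed simp
      qed
    qed (use int(1) in \<open>simp_all add: set_integrable_def\<close>)
    finally show ?thesis .
  qed
  have "(\<lambda>n. J (inverse (real (Suc n)))) \<longlonglongrightarrow> (LINT m:\<Omega>|\<mu>. \<bar>\<phi> m\<bar> powr p)"
    unfolding J_def set_lebesgue_integral_def
  proof (rule integral_dominated_convergence[where w = "\<lambda>m. indicator \<Omega> m *\<^sub>R (\<bar>\<phi> m\<bar> powr p)"])
    have [measurable]: "shifted_powr p e \<in> borel_measurable borel" for e
      unfolding shifted_powr_def[abs_def] by measurable
    show "(\<lambda>m. indicator \<Omega> m *\<^sub>R (\<bar>v m\<bar> powr (p - 2) * v m *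
        (\<bar>\<phi> m\<bar> powr p * shifted_powr p (inverse (real (Suc n))) (v m)))) \<in> borel_measurable \<mu>" for n
      by measurable
    \<comment> \<open>The powers of \<open>v\<close> combine to the factor
      \<open>v m powr (p - 1) * (v m + e) powr (1 - p)\<close>. It is at most 1, which gives the
      dominating function, and tends to 1, which gives the limit.\<close>
    have val: "\<bar>v m\<bar> powr (p - 2) * v m * (\<bar>\<phi> m\<bar> powr p * shifted_powr p e (v m)) =
        v m powr (p - 1) * (v m + e) powr (1 - p) * \<bar>\<phi> m\<bar> powr p" if "0 < v m" for m e
      using that by (simp add: shifted_powr_pos powr_diff power2_eq_square)
    show "AE m in \<mu>. norm (indicator \<Omega> m *\<^sub>R (\<bar>v m\<bar> powr (p - 2) * v m *
        (\<bar>\<phi> m\<bar> powr p * shifted_powr p (inverse (real (Suc n))) (v m))))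
        \<le> indicator \<Omega> m *\<^sub>R (\<bar>\<phi> m\<bar> powr p)" for n
      using pos
    proof eventually_elim
      case (elim m)
      show ?case
      proof (cases "m \<in> \<Omega>")
        case True
        then have v: "0 < v m" using elim by blast
        let ?e = "inverse (real (Suc n))"
        have "(v m + ?e) powr (1 - p) \<le> v m powr (1 - p)"
          using v p by (intro powr_mono2') auto
        then have "v m powr (p - 1) * (v m + ?e) powr (1 - p) \<le> v m powr (p - 1) * v m powr (1 - p)"
          by (intro mult_left_mono) auto
        also have "\<dots> = 1" using v by (simp add: powr_add[symmetric])
        finally have "v m powr (p - 1) * (v m + ?e) powr (1 - p) * \<bar>\<phi> m\<bar> powr p \<le> 1 * \<bar>\<phi> m\<bar> powr p"
          by (rule mult_right_mono) simp
        then show ?thesis using True by (simp only: val[OF v]) (simp add: abs_mult)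
      qed simp
    qed
    show "AE m in \<mu>. (\<lambda>n. indicator \<Omega> m *\<^sub>R (\<bar>v m\<bar> powr (p - 2) * v m *
        (\<bar>\<phi> m\<bar> powr p * shifted_powr p (inverse (real (Suc n))) (v m))))
        \<longlonglongrightarrow> indicator \<Omega> m *\<^sub>R (\<bar>\<phi> m\<bar> powr p)"
      using pos
    proof eventually_elim
      case (elim m)
      show ?case
      proof (cases "m \<in> \<Omega>")
        case True
        then have v: "0 < v m" using elim by blast
        have "(\<lambda>n. v m powr (p - 1) * (v m + inverse (real (Suc n))) powr (1 - p) * \<bar>\<phi> m\<bar> powr p)
            \<longlonglongrightarrow> v m powr (p - 1) * (v m + 0) powr (1 - p) * \<bar>\<phi> m\<bar> powr p"
          using v by (intro tendsto_intros LIMSEQ_inverse_real_of_nat) auto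
        also have "v m powr (p - 1) * (v m + 0) powr (1 - p) = 1"
          using v by (simp add: powr_add[symmetric])
        finally show ?thesis using True by (simp only: val[OF v]) simp
      qed simp
    qed
  qed (use int(2) in \<open>simp_all add: set_integrable_def\<close>)
  then have "(\<lambda>n. l * J (inverse (real (Suc n)))) \<longlonglongrightarrow> l * (LINT m:\<Omega>|\<mu>. \<bar>\<phi> m\<bar> powr p)"
    by (rule tendsto_mult_left)
  then show ?thesis
    by (rule LIMSEQ_le_const2) (auto intro!: le)
qed

text \<open>The sign of \<open>l\<close> allows the real inequality on \<open>C01\<close> to be
  rewritten with extended integrals, where the limit is taken. Both integrals in the limit are
  finite, so the result can be read in the reals again.\<close>

lemma S0_grad_frequency_bound:
  assumes v: "S0_grad A a \<mu> p \<Omega> v G" "v \<in> borel_measurable \<mu>" "G \<in> borel_measurable \<mu>"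
    and "open \<Omega>" and p: "1 < p" and "0 \<le> l"
    and pos: "AE m in \<mu>. m \<in> \<Omega> \<longrightarrow> 0 < v m"
    and eigen: "\<And>\<phi> \<Phi>. S0_grad A a \<mu> p \<Omega> \<phi> \<Phi> \<Longrightarrow> (AE m in \<mu>. m \<in> \<Omega> \<longrightarrow> \<phi> m \<ge> 0) \<Longrightarrow>
      weak_eigen_eq \<mu> p \<Omega> l v G \<phi> \<Phi>"
    and u: "S0_grad A a \<mu> p \<Omega> u H" "u \<in> borel_measurable \<mu>" "H \<in> borel_measurable \<mu>"
    and one: "(LINT m:\<Omega>|\<mu>. \<bar>u m\<bar> powr p) = 1"
  shows "l \<le> (LINT m:\<Omega>|\<mu>. norm (H m) powr p)"
proof -
  have [measurable]: "\<Omega> \<in> sets \<mu>" using \<open>open \<Omega>\<close> sets_meas by simp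
  note [measurable] = u(2,3)
  have "ennreal l * (\<integral>\<^sup>+m\<in>\<Omega>. ennreal (\<bar>\<phi> m\<bar> powr p) \<partial>\<mu>) \<le>
      (\<integral>\<^sup>+m\<in>\<Omega>. ennreal (norm (nabla_X A a \<phi> m) powr p) \<partial>\<mu>)" if \<phi>: "\<phi> \<in> C01 A \<Omega>" for \<phi>
  proof -
    show ?thesis
      using C01_frequency_bound[OF v(1) \<open>open \<Omega>\<close> p v(2,3) pos eigen \<phi>] \<open>0 \<le> l\<close>
        C01_powr_set_integrable[OF \<phi> \<open>open \<Omega>\<close>, of p] p
      by (simp add: nn_set_integral_eq_set_integral ennreal_mult'[symmetric] ennreal_leI)
  qed
  then have le: "ennreal l * (\<integral>\<^sup>+m\<in>\<Omega>. ennreal (\<bar>u m\<bar> powr p) \<partial>\<mu>) \<le>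
      (\<integral>\<^sup>+m\<in>\<Omega>. ennreal (norm (H m) powr p) \<partial>\<mu>)"
    by (rule S0_grad_Poincare[OF u(1) \<open>open \<Omega>\<close> p u(2,3)])
  \<comment> \<open>A function that is not integrable would have integral 0, not 1.\<close>
  have "set_integrable \<mu> \<Omega> (\<lambda>m. \<bar>u m\<bar> powr p)"
    using one not_integrable_integral_eq unfolding set_integrable_def set_lebesgue_integral_def
    by fastforce
  moreover have "set_integrable \<mu> \<Omega> (\<lambda>m. norm (H m) powr p)"
    unfolding set_integrable_def
  proof (rule integrableI_bounded)
    have "(\<integral>\<^sup>+m. ennreal (norm (indicator \<Omega> m *\<^sub>R (norm (H m) powr p))) \<partial>\<mu>) =
        (\<integral>\<^sup>+m\<in>\<Omega>. ennreal (norm (H m) powr p) \<partial>\<mu>)"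
      by (intro nn_integral_cong) (simp add: indicator_def)
    then show "(\<integral>\<^sup>+m. ennreal (norm (indicator \<Omega> m *\<^sub>R (norm (H m) powr p))) \<partial>\<mu>) < \<infinity>"
      using S0_grad_powr_finite[OF u(1) \<open>open \<Omega>\<close> _ u(3)] p by simp
  qed measurable
  moreover have "0 \<le> (LINT m:\<Omega>|\<mu>. norm (H m) powr p)"
    unfolding set_lebesgue_integral_def by (intro integral_nonneg_AE) simp
  ultimately show ?thesis
    using le one \<open>0 \<le> l\<close> by (simp add: nn_set_integral_eq_set_integral)
qed

text \<open>With \<open>v\<close> as its own test function the integrands become \<open>p\<close>-th
  powers, and \<open>weak_eigen_eq\<close> itself provides the integrability of
  \<open>\<bar>v\<bar> powr p\<close>. Since \<open>v\<close> is not almost everywhere zero, its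
  integral is positive and can be normalised.\<close>

lemma eigenvalue_attained:
  assumes v: "S0_grad A a \<mu> p \<Omega> v G" "v \<in> borel_measurable \<mu>" "G \<in> borel_measurable \<mu>"
    and "open \<Omega>" and p: "1 < p"
    and eigen: "weak_eigen_eq \<mu> p \<Omega> l v G v G"
    and nonzero: "\<not> (AE m in \<mu>. m \<in> \<Omega> \<longrightarrow> v m = 0)"
  obtains c where "S0_grad A a \<mu> p \<Omega> (\<lambda>m. c * v m) (\<lambda>m. c *\<^sub>R G m)"
    "(LINT m:\<Omega>|\<mu>. \<bar>c * v m\<bar> powr p) = 1" "(LINT m:\<Omega>|\<mu>. norm (c *\<^sub>R G m) powr p) = l"
proof -
  have sq: "norm x powr (p - 2) * inner x x = norm x powr p" for x :: "real ^ 'k"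
    by (cases "x = 0") (simp_all add: powr_diff power2_norm_eq_inner[symmetric])
  have sq': "\<bar>t\<bar> powr (p - 2) * t * t = \<bar>t\<bar> powr p" for t :: real
    by (cases "t = 0") (simp_all add: powr_diff power2_eq_square)
  let ?V = "LINT m:\<Omega>|\<mu>. \<bar>v m\<bar> powr p"
  have int: "set_integrable \<mu> \<Omega> (\<lambda>m. \<bar>v m\<bar> powr p)"
    and eq: "(LINT m:\<Omega>|\<mu>. norm (G m) powr p) = l * ?V"
    using eigen unfolding weak_eigen_eq_def sq sq' by auto
  have "?V \<noteq> 0"
  proof
    assume "?V = 0"
    then have "AE m in \<mu>. indicator \<Omega> m *\<^sub>R (\<bar>v m\<bar> powr p) = 0"
      using int unfolding set_integrable_def set_lebesgue_integral_def
      by (subst (asm) integral_nonneg_eq_0_iff_AE) auto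
    then have "AE m in \<mu>. m \<in> \<Omega> \<longrightarrow> v m = 0" by eventually_elim auto
    then show False using nonzero by blast
  qed
  moreover have "0 \<le> ?V" unfolding set_lebesgue_integral_def by (intro integral_nonneg_AE) simp
  ultimately have V: "0 < ?V" by linarith
  \<comment> \<open>The exponent is chosen so that
    \<open>\<bar>c\<bar> powr p * ?V = 1\<close>.\<close>
  define c where "c = ?V powr (- 1 / p)"
  have c: "\<bar>c\<bar> powr p = 1 / ?V"
    using V p by (simp add: c_def powr_divide powr_powr)
  show thesis
  proof
    show "S0_grad A a \<mu> p \<Omega> (\<lambda>m. c * v m) (\<lambda>m. c *\<^sub>R G m)"
      by (rule S0_grad_scale[OF v(1) \<open>open \<Omega>\<close> v(2,3)])
    show "(LINT m:\<Omega>|\<mu>. \<bar>c * v m\<bar> powr p) = 1"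
      using V by (simp add: abs_mult powr_mult c)
    show "(LINT m:\<Omega>|\<mu>. norm (c *\<^sub>R G m) powr p) = l"
      using V by (simp add: powr_mult c eq)
  qed
qed

end

theorem corollary2p3:
  fixes A :: "('m::{t2_space, second_countable_topology}, 'n::finite) chart set"
    and w :: "('m, 'n) chart \<Rightarrow> real ^ 'n \<Rightarrow> real"
    and \<mu> :: "'m measure"
    and a :: "('m, 'n) chart \<Rightarrow> 'k::finite \<Rightarrow> real ^ 'n \<Rightarrow> real ^ 'n"
    and p lam1 lam :: real
    and \<Omega> :: "'m set"
    and u1 v :: "'m \<Rightarrow> real"
    and Gu1 Gv :: "'m \<Rightarrow> real ^ 'k"
  assumes "smooth_atlas A" and "volume_form A w" and "volume_measure A w \<mu>"
    and "vector_fields A a" and "CARD('k) \<le> CARD('n)"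
    and "1 < p" and "open \<Omega>"
    and "principal_frequency A a \<mu> p \<Omega> lam1"
    and "S0_grad A a \<mu> p \<Omega> u1 Gu1"
    and "AE m in \<mu>. m \<in> \<Omega> \<longrightarrow> u1 m > 0"
    and "\<And>\<phi> \<Phi>. S0_grad A a \<mu> p \<Omega> \<phi> \<Phi> \<Longrightarrow> weak_eigen_eq \<mu> p \<Omega> lam1 u1 Gu1 \<phi> \<Phi>"
    and "S0_grad A a \<mu> p \<Omega> v Gv"
    and "AE m in \<mu>. m \<in> \<Omega> \<longrightarrow> v m > 0"
    and "\<And>\<phi> \<Phi>. S0_grad A a \<mu> p \<Omega> \<phi> \<Phi> \<Longrightarrow> (AE m in \<mu>. m \<in> \<Omega> \<longrightarrow> \<phi> m \<ge> 0) \<Longrightarrow>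
           weak_eigen_eq \<mu> p \<Omega> lam v Gv \<phi> \<Phi>"
  shows "lam1 = lam"
proof -
  interpret horizontal_frame A w \<mu> a
    by unfold_locales fact+
  \<comment> \<open>From here on \<open>v\<close> and its gradient are replaced by globally Borel
    representatives; the equation and the positivity on \<Omega> are unchanged.\<close>
  let ?v = "\<lambda>m. indicator \<Omega> m *\<^sub>R v m" and ?G = "\<lambda>m. indicator \<Omega> m *\<^sub>R Gv m"
  have v: "S0_grad A a \<mu> p \<Omega> ?v ?G" "?v \<in> borel_measurable \<mu>" "?G \<in> borel_measurable \<mu>"
    using S0_grad_zero_extension S0_grad_measurable assms(12) by blast+
  have pos: "AE m in \<mu>. m \<in> \<Omega> \<longrightarrow> 0 < ?v m"
    using assms(13) by eventually_elim simp
  have eigen: "weak_eigen_eq \<mu> p \<Omega> lam ?v ?G \<phi> \<Phi>"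
    if "S0_grad A a \<mu> p \<Omega> \<phi> \<Phi>" "AE m in \<mu>. m \<in> \<Omega> \<longrightarrow> \<phi> m \<ge> 0" for \<phi> \<Phi>
    unfolding weak_eigen_eq_zero_extension using that by (rule assms(14))
  obtain u H where u: "S0_grad A a \<mu> p \<Omega> u H" "(LINT m:\<Omega>|\<mu>. \<bar>u m\<bar> powr p) = 1"
    and lam1: "lam1 = (LINT m:\<Omega>|\<mu>. norm (H m) powr p)"
    using assms(8) unfolding principal_frequency_def Let_def by blast
  have min: "lam1 \<le> (LINT m:\<Omega>|\<mu>. norm (H m) powr p)"
    if "S0_grad A a \<mu> p \<Omega> u H" "(LINT m:\<Omega>|\<mu>. \<bar>u m\<bar> powr p) = 1" for u H
    using assms(8) that unfolding principal_frequency_def Let_def by blast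
  have "0 \<le> lam1"
    unfolding lam1 set_lebesgue_integral_def by (intro integral_nonneg_AE) simp
  \<comment> \<open>If a function positive almost everywhere on \<Omega> also vanished almost
    everywhere there, \<Omega> would be a null set, and no minimiser could be normalised.\<close>
  have nonzero: "\<not> (AE m in \<mu>. m \<in> \<Omega> \<longrightarrow> ?v m = 0)"
  proof
    assume "AE m in \<mu>. m \<in> \<Omega> \<longrightarrow> ?v m = 0"
    with pos have "AE m in \<mu>. indicator \<Omega> m *\<^sub>R (\<bar>u m\<bar> powr p) = 0"
      by eventually_elim (auto simp: indicator_def)
    then have "(LINT m:\<Omega>|\<mu>. \<bar>u m\<bar> powr p) = 0"
      unfolding set_lebesgue_integral_def by (rule integral_eq_zero_AE)
    then show False using u(2) by simp
  qed
  have "weak_eigen_eq \<mu> p \<Omega> lam ?v ?G ?v ?G"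
    by (rule eigen[OF v(1)]) (use pos in eventually_elim, auto)
  then obtain c where c: "S0_grad A a \<mu> p \<Omega> (\<lambda>m. c * ?v m) (\<lambda>m. c *\<^sub>R ?G m)"
    "(LINT m:\<Omega>|\<mu>. \<bar>c * ?v m\<bar> powr p) = 1" "(LINT m:\<Omega>|\<mu>. norm (c *\<^sub>R ?G m) powr p) = lam"
    by (rule eigenvalue_attained[OF v assms(7,6) _ nonzero])
  have le: "lam1 \<le> lam" using min[OF c(1,2)] unfolding c(3) .
  have "lam \<le> (LINT m:\<Omega>|\<mu>. norm (indicator \<Omega> m *\<^sub>R H m) powr p)"
  proof (rule S0_grad_frequency_bound[OF v assms(7,6) _ pos eigen])
    show "0 \<le> lam" using \<open>0 \<le> lam1\<close> le by linarith
    show "(LINT m:\<Omega>|\<mu>. \<bar>indicator \<Omega> m *\<^sub>R u m\<bar> powr p) = 1"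
      using u(2) set_lebesgue_integral_powr_zero_extension[of \<mu> \<Omega> u p] by simp
  qed (use S0_grad_zero_extension[OF u(1)] S0_grad_measurable[OF u(1)] in auto)
  then have "lam \<le> lam1" unfolding lam1 set_lebesgue_integral_powr_zero_extension .
  with le show ?thesis by simp
qed

end
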